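(* Consider the 2-sphere $\mathbb S^2$ endowed with the standard metric. There exist an absolute constant $C>0$, a sequence of real Laplace-Beltrami eigenfunctions $f_i$, $i\in\mathbb N$ (not identically zero), corresponding to eigenvalues $\lambda_i\to\infty$, i.e. $\Delta f_i+\lambda_i f_i=0$, and a sequence of metric discs $D_i\subset\mathbb S^2$ such that each $f_i$ vanishes at the center of $D_i$ and $$\frac{\operatorname{Area}(\{f_i>0\}\cap D_i)}{\operatorname{Area}(D_i)}\ \le\ \frac{C}{\log\lambda_i}\,.$$
   Context: Area and discs are taken with respect to the standard spherical metric; the radii of all metric discs are assumed to be positive and less than the injectivity radius of the sphere. *)

theory Defs
  imports "HOL-Analysis.Analysis"
begin

text \<open>
  Functions and vector fields on the sphere are represented by functions on the ambient space
  of which only the values on \<open>S2\<close> matter: every derivative below is taken within \<open>S2\<close>.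
\<close>

abbreviation S2 :: "(real ^ 3) set" where
  "S2 \<equiv> sphere 0 1"


subsection \<open>Discs and area\<close>

text \<open>
  The great circle distance; the injectivity radius of the unit sphere is \<open>pi\<close>.
\<close>

definition sphere_dist :: "real ^ 3 \<Rightarrow> real ^ 3 \<Rightarrow> real" where
  "sphere_dist x y = arccos (x \<bullet> y)"

definition sphere_disc :: "real ^ 3 \<Rightarrow> real \<Rightarrow> (real ^ 3) set" where
  "sphere_disc c r = {x \<in> S2. sphere_dist c x < r}"

definition sphere_coords :: "real \<times> real \<Rightarrow> real ^ 3" where
  "sphere_coords = (\<lambda>(\<theta>, \<phi>). vector [sin \<theta> * cos \<phi>, sin \<theta> * sin \<phi>, cos \<theta>])"

text \<open>
  In these coordinates the metric is \<open>d\<theta>\<^sup>2 + sin\<^sup>2 \<theta> d\<phi>\<^sup>2\<close>, so the Riemannian area element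
  is \<open>sin \<theta> d\<theta> d\<phi>\<close>; the chart misses only a half great circle, which has area zero.
\<close>

definition sphere_area :: "(real ^ 3) measure" where
  "sphere_area =
     distr (density (restrict_space lborel ({0<..<pi} \<times> {0<..<2 * pi}))
                    (\<lambda>(\<theta>, \<phi>). ennreal (sin \<theta>)))
           (restrict_space borel S2) sphere_coords"


subsection \<open>The Laplace-Beltrami operator\<close>

text \<open>
  The class of functions whose partial derivatives up to order \<open>k\<close> exist (as iterated Frechet
  derivatives) and are continuous; meaningful for open \<open>U\<close>.
\<close>

primrec Ck_on :: "nat \<Rightarrow> (real ^ 3) set \<Rightarrow> (real ^ 3 \<Rightarrow> real) \<Rightarrow> bool" where
  "Ck_on 0 U F \<longleftrightarrow> continuous_on U F"
| "Ck_on (Suc k) U F \<longleftrightarrow>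
     F differentiable_on U \<and> (\<forall>b\<in>Basis. Ck_on k U (\<lambda>x. frechet_derivative F (at x) b))"

definition smooth_on_sphere :: "(real ^ 3 \<Rightarrow> real) \<Rightarrow> bool" where
  "smooth_on_sphere f \<longleftrightarrow>
     (\<exists>U F. open U \<and> S2 \<subseteq> U \<and> (\<forall>k. Ck_on k U F) \<and> (\<forall>x\<in>S2. F x = f x))"

text \<open>
  The tangent space at \<open>p \<in> S2\<close> is the orthogonal complement of \<open>p\<close>. A derivative within \<open>S2\<close>
  is determined on tangent vectors only, whence the tangency condition on the gradient.
\<close>

definition sphere_grad :: "(real ^ 3 \<Rightarrow> real) \<Rightarrow> real ^ 3 \<Rightarrow> real ^ 3" where
  "sphere_grad f p =
     (THE g. g \<bullet> p = 0 \<and> (f has_derivative (\<lambda>h. g \<bullet> h)) (at p within S2))"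

text \<open>
  The divergence of a tangent field \<open>X\<close> is the trace of its covariant derivative. The
  Levi-Civita derivative in direction \<open>e\<close> is the tangential part of \<open>X' e\<close>, so the projection
  disappears once the inner product with a tangent vector is taken. The value does not
  depend on the choice of \<open>X'\<close> and of the orthonormal basis \<open>u, v\<close> of the tangent plane.
\<close>

definition sphere_div :: "(real ^ 3 \<Rightarrow> real ^ 3) \<Rightarrow> real ^ 3 \<Rightarrow> real" where
  "sphere_div X p =
     (THE d. \<exists>X' u v. (X has_derivative X') (at p within S2) \<and>
        u \<bullet> p = 0 \<and> v \<bullet> p = 0 \<and> u \<bullet> v = 0 \<and> norm u = 1 \<and> norm v = 1 \<and>
        d = X' u \<bullet> u + X' v \<bullet> v)"

definition sphere_laplacian :: "(real ^ 3 \<Rightarrow> real) \<Rightarrow> real ^ 3 \<Rightarrow> real" where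
  "sphere_laplacian f = sphere_div (sphere_grad f)"

definition sphere_eigenfunction :: "(real ^ 3 \<Rightarrow> real) \<Rightarrow> real \<Rightarrow> bool" where
  "sphere_eigenfunction f \<mu> \<longleftrightarrow>
     smooth_on_sphere f \<and> (\<exists>p\<in>S2. f p \<noteq> 0) \<and>
     (\<forall>p\<in>S2. sphere_laplacian f p + \<mu> * f p = 0)"

end

theory Submission
  imports Defs "HOL-Complex_Analysis.Cauchy_Integral_Theorem"
begin

text \<open>
  The integral of \<open>exp (\<zeta> s) (1 + s) powr (- s)\<close> over \<open>s > 0\<close> is an entire function of \<open>\<zeta>\<close> that is
  bounded off a horizontal half-strip (rotate the path of integration to the imaginary axis), but
  large at some point of the half-strip. Its Taylor polynomials of degree \<open>exp (O R)\<close> approximate it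
  on the disc of radius \<open>R\<close>. Hence there is a polynomial \<open>Q\<close> of degree \<open>n\<close> with \<open>Q 0 = 0\<close> whose real
  part is negative on the disc of radius \<open>R \<approx> ln n\<close> off a strip of bounded width, that is, off a
  set of relative area \<open>O (1 / R)\<close>.

  Every polynomial of degree at most \<open>n\<close> is a local limit of spherical harmonics of degree \<open>n\<close>:
  it is a combination of powers \<open>(1 + w \<zeta>) ^ n\<close>, and such a power is the limit, on discs of radius
  \<open>\<epsilon> R\<close> with \<open>\<epsilon> \<rightarrow> 0\<close>, of the \<open>n\<close>-th power of a complex linear form with isotropic coefficient vector.
\<close>

subsection \<open>An entire function bounded off a half-strip\<close>

text \<open>The factor \<open>exp (2 * s)\<close> only translates the variable, so that the value at \<open>0\<close> exceeds the
  bound off the half-strip.\<close>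

definition weight :: "real \<Rightarrow> real" where
  "weight s = exp (2 * s - s * ln (1 + s))"

text \<open>The integral is cut off at a finite \<open>T\<close>, so no convergence question arises;
  \<open>T\<close> is later tied to the radius \<open>R\<close> of the disc.\<close>

definition rotint :: "real \<Rightarrow> complex \<Rightarrow> complex" where
  "rotint T \<zeta> = integral {0..T} (\<lambda>s. exp (\<zeta> * of_real s) * of_real (weight s))"

lemma weight_pos: "0 < weight s"
  by (simp add: weight_def)

lemma weight_le: "0 \<le> s \<Longrightarrow> weight s \<le> exp (2 * s)"
  by (simp add: weight_def)

lemma continuous_on_weight: "continuous_on {0..T} weight"
  unfolding weight_def by (intro continuous_intros) auto

lemma rotint_integrable:
  "(\<lambda>s. exp (\<zeta> * of_real s) * complex_of_real (weight s)) integrable_on {0..T}"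
  by (intro integrable_continuous_real continuous_intros continuous_on_weight)

text \<open>The second assumption says that the integrand is at most \<open>exp (- s)\<close>, whose
  integral stays below 1.\<close>

lemma rotint_norm_bound:
  assumes "0 \<le> T" "\<And>s. s \<in> {0..T} \<Longrightarrow> Re \<zeta> * s + 2 * s - s * ln (1 + s) \<le> - s"
  shows "norm (rotint T \<zeta>) \<le> 1"
proof -
  have I: "((\<lambda>s. exp (- s)) has_integral (- exp (- T) - (- exp (- 0)))) {0..T}"
    by (rule fundamental_theorem_of_calculus[OF assms(1)])
       (auto intro!: derivative_eq_intros simp: has_real_derivative_iff_has_vector_derivative[symmetric])
  have "norm (rotint T \<zeta>) \<le> integral {0..T} (\<lambda>s. exp (- s))"
    unfolding rotint_def
  proof (rule integral_norm_bound_integral[OF rotint_integrable])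
    show "(\<lambda>s. exp (- s)) integrable_on {0..T}" using I by blast
    fix s assume "s \<in> {0..T}"
    then show "norm (exp (\<zeta> * of_real s) * complex_of_real (weight s)) \<le> exp (- s)"
      using assms(2)[of s] by (simp add: norm_mult weight_def exp_add[symmetric] algebra_simps)
  qed
  also have "\<dots> = 1 - exp (- T)" using I by (simp add: integral_unique)
  also have "\<dots> \<le> 1" by simp
  finally show ?thesis .
qed

lemma rotint_left:
  assumes "0 \<le> T" "Re \<zeta> \<le> - 3"
  shows "norm (rotint T \<zeta>) \<le> 1"
proof (rule rotint_norm_bound[OF assms(1)])
  fix s assume s: "s \<in> {0..T}"
  have "Re \<zeta> * s \<le> - 3 * s" using s assms by (intro mult_right_mono) auto
  moreover have "0 \<le> s * ln (1 + s)" using s by simp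
  ultimately show "Re \<zeta> * s + 2 * s - s * ln (1 + s) \<le> - s" by simp
qed

text \<open>The weight is real. This reduces points below the half-strip to points above it.\<close>

lemma rotint_cnj: "rotint T (cnj \<zeta>) = cnj (rotint T \<zeta>)"
  by (simp add: rotint_def integral_cnj exp_cnj)

text \<open>Writing the integrand with the principal branch \<open>Ln (1 + t)\<close> makes it
  holomorphic on the closed right half-plane, where the path may be moved.\<close>

lemma rotint_contour:
  assumes "0 \<le> T"
  shows "rotint T \<zeta> = contour_integral (linepath 0 (of_real T))
           (\<lambda>t. exp (\<zeta> * t + 2 * t - t * Ln (1 + t)))"
proof -
  have "contour_integral (linepath (of_real 0) (of_real T)) (\<lambda>t. exp (\<zeta> * t + 2 * t - t * Ln (1 + t)))
     = integral {0..T} (\<lambda>s. exp (\<zeta> * of_real s + 2 * of_real s - of_real s * Ln (1 + of_real s)))"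
    using assms by (cases "T = 0") (simp, subst contour_integral_linepath_Reals_eq, auto)
  also have "\<dots> = rotint T \<zeta>"
    unfolding rotint_def
  proof (rule integral_cong)
    fix s assume "s \<in> {0..T}"
    then have "Ln (of_real (1 + s)) = of_real (ln (1 + s))" by (intro Ln_of_real) auto
    then have "Ln (1 + of_real s) = of_real (ln (1 + s))" by simp
    then show "exp (\<zeta> * of_real s + 2 * of_real s - of_real s * Ln (1 + of_real s)) =
      exp (\<zeta> * of_real s) * complex_of_real (weight s)"
      by (simp add: weight_def exp_of_real[symmetric] exp_add[symmetric] algebra_simps)
  qed
  finally show ?thesis by simp
qed

text \<open>With L = \<open>Ln (1 + t)\<close> the real part is
  \<open>Re t * (Re \<zeta> + 2 - Re L) - Im t * (Im \<zeta> - Im L)\<close>. The argument Im L is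
  below pi / 2 < 2, so the second bracket is at least 1; the first is at most -1 when
  \<open>norm (1 + t)\<close> is large, and its term vanishes on the imaginary axis.\<close>

lemma Re_exponent_bound:
  assumes "0 \<le> Re t" "0 \<le> Im t" "3 \<le> Im \<zeta>" "Re \<zeta> + 3 \<le> ln (norm (1 + t)) \<or> Re t = 0"
  shows "Re (\<zeta> * t + 2 * t - t * Ln (1 + t)) \<le> - (Re t + Im t)"
proof -
  have nz: "1 + t \<noteq> 0" using assms(1) by (auto simp: complex_eq_iff)
  have "\<bar>Im (Ln (1 + t))\<bar> < pi / 2" using assms(1) nz by (subst Re_Ln_pos_lt) auto
  then have "Im (Ln (1 + t)) \<le> 2" using pi_less_4 by simp
  then have 1: "Im t * (Im (Ln (1 + t)) - Im \<zeta>) \<le> Im t * (- 1)"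
    using assms by (intro mult_left_mono) auto
  have 2: "Re t * (Re \<zeta> + 2 - Re (Ln (1 + t))) \<le> Re t * (- 1)"
  proof (cases "Re t = 0")
    case False
    then show ?thesis using assms nz by (intro mult_left_mono) auto
  qed simp
  show ?thesis using 1 2 by (simp add: algebra_simps)
qed

text \<open>Move the segment from \<open>0\<close> to \<open>T\<close> to the imaginary axis, where the integrand is at most
  \<open>exp (- s)\<close>; \<open>T\<close> is so large that it is at most \<open>exp (- T)\<close> on the segment from \<open>T\<close> to \<open>\<i> T\<close>.\<close>

lemma rotint_above:
  assumes R: "0 \<le> R" and T: "T = 2 * exp (R + 3)" and z: "Re \<zeta> \<le> R" "3 \<le> Im \<zeta>"
  shows "norm (rotint T \<zeta>) \<le> 2"
proof -
  define g where "g = (\<lambda>t. exp (\<zeta> * t + 2 * t - t * Ln (1 + t)))"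
  have T2: "T \<ge> 2" using R T by simp
  let ?a = "0 :: complex" and ?b = "complex_of_real T" and ?c = "\<i> * complex_of_real T"
  have conv: "convex {t. 0 \<le> Re t}" by (rule convex_halfspace_Re_ge)
  have sub: "convex hull {?a, ?b, ?c} \<subseteq> {t. 0 \<le> Re t}"
    using T2 by (intro hull_minimal conv) auto
  have "g holomorphic_on {t. 0 \<le> Re t}"
    unfolding g_def by (intro holomorphic_intros) (auto simp: complex_nonpos_Reals_iff)
  then have hol: "g holomorphic_on convex hull {?a, ?b, ?c}" using sub holomorphic_on_subset by blast
  have cont: "continuous_on {t. 0 \<le> Re t} g"
    using \<open>g holomorphic_on {t. 0 \<le> Re t}\<close> by (rule holomorphic_on_imp_continuous_on)
  have seg: "g contour_integrable_on linepath x y" if "0 \<le> Re x" "0 \<le> Re y" for x y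
    using that by (intro contour_integrable_continuous_linepath continuous_on_subset[OF cont]
        closed_segment_subset conv) auto
  have tri: "(g has_contour_integral 0) (linepath ?a ?b +++ linepath ?b ?c +++ linepath ?c ?a)"
    using Cauchy_theorem_triangle[OF hol] .
  have sum0: "contour_integral (linepath ?a ?b) g + contour_integral (linepath ?b ?c) g
           + contour_integral (linepath ?c ?a) g = 0"
    using contour_integral_unique[OF tri] T2 seg
    by (simp add: contour_integrable_joinI contour_integral_join add.assoc)
  have I2: "norm (contour_integral (linepath ?b ?c) g) \<le> exp (- T) * norm (?c - ?b)"
  proof (rule contour_integral_bound_linepath)
    show "g contour_integrable_on linepath ?b ?c" using seg T2 by simp
    fix t assume "t \<in> closed_segment ?b ?c"
    then obtain u where u: "0 \<le> u" "u \<le> 1" and t: "t = (1 - u) *\<^sub>R ?b + u *\<^sub>R ?c"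
      by (auto simp: closed_segment_def)
    have ri: "Re t = (1 - u) * T" "Im t = u * T" using t by simp_all
    \<comment> \<open>On this segment the real and imaginary parts of \<open>t\<close> add up to
      \<open>T\<close>, so one of them is at least \<open>T / 2 = exp (R + 3)\<close>.\<close>
    have "T / 2 \<le> norm (1 + t)"
    proof (cases "u \<le> 1 / 2")
      case True
      have "T / 2 \<le> (1 - u) * T" using True T2 mult_right_mono[of "1/2" "1-u" T] by simp
      also have "\<dots> \<le> Re (1 + t)" using ri by simp
      finally show ?thesis using complex_Re_le_cmod order_trans by blast
    next
      case False
      have "T / 2 \<le> u * T" using False T2 mult_right_mono[of "1/2" u T] by simp
      also have "\<dots> = Im (1 + t)" using ri by simp
      also have "\<dots> \<le> norm (1 + t)" using abs_Im_le_cmod[of "1 + t"] by linarith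
      finally show ?thesis .
    qed
    then have "exp (R + 3) \<le> norm (1 + t)" using T by simp
    then have "R + 3 \<le> ln (norm (1 + t))" by (metis exp_gt_zero exp_le_cancel_iff exp_ln less_le_trans)
    then have "Re (\<zeta> * t + 2 * t - t * Ln (1 + t)) \<le> - (Re t + Im t)"
      using z u T2 ri by (intro Re_exponent_bound) auto
    also have "\<dots> = - T" using ri by (simp add: algebra_simps)
    finally show "norm (g t) \<le> exp (- T)" by (simp add: g_def)
  qed simp
  also have "\<dots> \<le> exp (- T) * (2 * T)"
  proof -
    have "norm (?c - ?b) \<le> norm ?c + norm ?b" by (rule norm_triangle_ineq4)
    then show ?thesis using T2 by (intro mult_left_mono) (auto simp: norm_mult)
  qed
  also have "\<dots> \<le> 1"
  proof -
    have "2 * T \<le> 1 + T + T\<^sup>2 / 2" using zero_le_power2[of "T - 1"] by (simp add: power2_eq_square algebra_simps)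
    also have "\<dots> \<le> exp T" using T2 by (intro exp_lower_Taylor_quadratic) simp
    finally show ?thesis by (simp add: exp_minus field_simps)
  qed
  finally have I2': "norm (contour_integral (linepath ?b ?c) g) \<le> 1" .
  \<comment> \<open>The majorant on the imaginary segment: parameter \<open>x\<close> is the point
    \<open>\<i> * (1 - x) * T\<close>, and the path has speed \<open>T\<close>.\<close>
  have J: "((\<lambda>x. T * exp (T * (x - 1))) has_integral (exp (T * (1 - 1)) - exp (T * (0 - 1)))) {0..1}"
    by (rule fundamental_theorem_of_calculus)
       (auto intro!: derivative_eq_intros simp: has_real_derivative_iff_has_vector_derivative[symmetric])
  have I3: "norm (contour_integral (linepath ?c ?a) g) \<le> 1"
  proof -
    have int: "(\<lambda>x. g (linepath ?c ?a x) * (?a - ?c)) integrable_on {0..1}"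
      using seg[of ?c ?a] by (simp add: contour_integrable_on)
    have "contour_integral (linepath ?c ?a) g = integral {0..1} (\<lambda>x. g (linepath ?c ?a x) * (?a - ?c))"
      by (simp add: contour_integral_integral)
    also have "norm \<dots> \<le> integral {0..1} (\<lambda>x. T * exp (T * (x - 1)))"
    proof (rule integral_norm_bound_integral[OF int])
      show "(\<lambda>x. T * exp (T * (x - 1))) integrable_on {0..1}" using J by blast
      fix x :: real assume x: "x \<in> {0..1}"
      let ?t = "linepath ?c ?a x"
      have ri: "Re ?t = 0" "Im ?t = (1 - x) * T" by (simp_all add: linepath_def)
      have "Re (\<zeta> * ?t + 2 * ?t - ?t * Ln (1 + ?t)) \<le> - (Re ?t + Im ?t)"
        using x T2 z ri by (intro Re_exponent_bound) auto
      then have "norm (g ?t) \<le> exp (- ((1 - x) * T))" unfolding g_def norm_exp_eq_Re ri by simp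
      then have "norm (g ?t) \<le> exp (T * (x - 1))" by (simp add: algebra_simps)
      then show "norm (g ?t * (?a - ?c)) \<le> T * exp (T * (x - 1))"
        using T2 by (simp add: norm_mult mult.commute)
    qed
    also have "\<dots> \<le> 1" using integral_unique[OF J] by simp
    finally show ?thesis .
  qed
  have "rotint T \<zeta> = - (contour_integral (linepath ?b ?c) g + contour_integral (linepath ?c ?a) g)"
    using sum0 T2 unfolding eq_neg_iff_add_eq_0 by (simp add: rotint_contour g_def[symmetric] add.assoc)
  also have "norm \<dots> \<le> 1 + 1"
    unfolding norm_minus_cancel using I2' I3 norm_triangle_mono by blast
  finally show ?thesis by simp
qed

lemma rotint_outside:
  assumes "0 \<le> R" "T = 2 * exp (R + 3)" "norm \<zeta> \<le> R" "Re \<zeta> \<le> - 3 \<or> 3 \<le> \<bar>Im \<zeta>\<bar>"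
  shows "norm (rotint T \<zeta>) \<le> 2"
proof -
  have re: "Re \<zeta> \<le> R" using assms(3) complex_Re_le_cmod order_trans by blast
  consider "Re \<zeta> \<le> - 3" | "3 \<le> Im \<zeta>" | "3 \<le> Im (cnj \<zeta>)" using assms(4) by fastforce
  then show ?thesis
  proof cases
    case 1
    then show ?thesis using rotint_left[of T \<zeta>] assms(2) by simp
  next
    case 2
    then show ?thesis using rotint_above assms re by blast
  next
    case 3
    then have "norm (rotint T (cnj \<zeta>)) \<le> 2" using rotint_above[OF assms(1,2)] re by simp
    then show ?thesis by (simp add: rotint_cnj)
  qed
qed

text \<open>On [0, 4] the weight is at least 1, because ln (1 + s) <= ln 5 <= 2 there. The value 4
  beats the bound 2 off the half-strip with room for a truncation error of 1.\<close>

lemma rotint_0: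
  assumes "4 \<le> T"
  shows "4 \<le> Re (rotint T 0)"
proof -
  have int: "weight integrable_on {a..b}" if "0 \<le> a" for a b
    using that continuous_on_subset[OF continuous_on_weight[of b]]
    by (intro integrable_continuous_real) auto
  have "rotint T 0 = integral {0..T} (\<lambda>s. of_real (weight s))" by (simp add: rotint_def)
  also have "\<dots> = of_real (integral {0..T} weight)"
    using has_integral_of_real[OF integrable_integral[OF int[of 0 T]], where 'b = complex]
    by (simp add: integral_unique)
  finally have eq: "Re (rotint T 0) = integral {0..T} weight" by simp
  have "4 = integral {0..4} (\<lambda>s::real. 1 :: real)" by simp
  also have "\<dots> \<le> integral {0..4} weight"
  proof (rule integral_le)
    fix s :: real assume s: "s \<in> {0..4}"
    have "1 + s \<le> 1 + 2 + 2\<^sup>2 / 2" using s by simp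
    also have "\<dots> \<le> exp 2" using exp_lower_Taylor_quadratic[of 2] by simp
    finally have "ln (1 + s) \<le> 2" using s by (metis add_pos_nonneg atLeastAtMost_iff exp_le_cancel_iff exp_ln zero_less_one)
    then have "s * ln (1 + s) \<le> s * 2" using s by (intro mult_left_mono) auto
    then show "1 \<le> weight s" by (simp add: weight_def)
  qed (use int in auto)
  also have "\<dots> \<le> integral {0..T} weight"
    using assms by (intro integral_subset_le int) (auto intro: less_imp_le weight_pos)
  finally show ?thesis using eq by simp
qed

section \<open>Taylor truncation of the integral to a polynomial\<close>

text \<open>In the Taylor remainder, x^n / n! is rewritten as (2x)^n / n! divided by 2^n, and (2x)^n
  / n! is a single term of the series of exp (2x).\<close>

lemma exp_truncation_bound:
  "norm (exp z - (\<Sum>k\<le>n. z ^ k / fact k)) \<le> exp (4 * norm z) / 2 ^ n" for z :: complex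
proof -
  let ?x = "norm z"
  have "norm (exp z - (\<Sum>k\<le>n. z ^ k / fact k)) \<le> exp ?x * (?x ^ Suc n) / fact n"
    by (rule Taylor_exp_field)
  also have "\<dots> = exp ?x * ?x * ((2 * ?x) ^ n / fact n) / 2 ^ n"
    by (simp add: power_mult_distrib)
  also have "\<dots> \<le> exp ?x * exp ?x * exp (2 * ?x) / 2 ^ n"
  proof (intro divide_right_mono mult_mono)
    show "(2 * ?x) ^ n / fact n \<le> exp (2 * ?x)"
    proof -
      have s: "(\<lambda>k. (2 * ?x) ^ k /\<^sub>R fact k) sums exp (2 * ?x)" by (rule exp_converges)
      have "(\<Sum>k\<in>{n}. (2 * ?x) ^ k /\<^sub>R fact k) \<le> exp (2 * ?x)"
        unfolding sums_unique[OF s] by (intro sum_le_suminf sums_summable[OF s]) auto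
      then show ?thesis by (simp add: divide_inverse mult.commute)
    qed
    show "?x \<le> exp ?x" using exp_ge_add_one_self[of ?x] by linarith
  qed (auto simp: abs_Re_le_cmod)
  also have "\<dots> = exp (4 * ?x) / 2 ^ n" by (simp add: exp_add[symmetric])
  finally show ?thesis .
qed

text \<open>The \<open>q k\<close> are the Taylor coefficients at 0: expand the exponential under
  the integral and integrate termwise. The error of the exponential is taken at
  \<open>norm \<zeta> \<le> R\<close> and s <= T, and the weight contributes
  \<open>exp (2 * T)\<close>.\<close>

lemma rotint_truncation:
  assumes "0 \<le> T" "norm \<zeta> \<le> R"
  defines "q \<equiv> \<lambda>k. integral {0..T} (\<lambda>s. of_real (s ^ k * weight s)) / fact k :: complex"
  shows "norm (rotint T \<zeta> - (\<Sum>k\<le>n. q k * \<zeta> ^ k)) \<le> T * exp ((4 * R + 2) * T) / 2 ^ n"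
proof -
  let ?P = "\<lambda>s. (\<Sum>k\<le>n. (\<zeta> * of_real s) ^ k / fact k) * complex_of_real (weight s)"
  have "((\<lambda>s. of_real (s ^ k * weight s)) has_integral fact k * q k) {0..T}" for k
    unfolding q_def
    by (simp del: of_real_mult) (intro integrable_integral integrable_continuous_real continuous_intros continuous_on_weight)
  then have "((\<lambda>s. \<Sum>k\<le>n. \<zeta> ^ k / fact k * of_real (s ^ k * weight s)) has_integral
     (\<Sum>k\<le>n. \<zeta> ^ k / fact k * (fact k * q k))) {0..T}"
    by (intro has_integral_sum has_integral_mult_right) auto
  then have P: "(?P has_integral (\<Sum>k\<le>n. q k * \<zeta> ^ k)) {0..T}"
    by (simp add: sum_distrib_left power_mult_distrib field_simps)
  have "((\<lambda>s. exp (\<zeta> * of_real s) * complex_of_real (weight s)) has_integral rotint T \<zeta>) {0..T}"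
    unfolding rotint_def by (intro integrable_integral rotint_integrable)
  note D = has_integral_diff[OF this P]
  have "norm (rotint T \<zeta> - (\<Sum>k\<le>n. q k * \<zeta> ^ k)) \<le> (exp ((4 * R + 2) * T) / 2 ^ n) * measure lborel {0..T}"
  proof (rule has_integral_bound_real[OF _ finite.emptyI D])
    have R: "0 \<le> R" using assms(2) norm_ge_zero order_trans by blast
    show "0 \<le> exp ((4 * R + 2) * T) / 2 ^ n" by simp
    fix s assume "s \<in> {0..T} - {}"
    then have s: "s \<in> {0..T}" by simp
    have "exp (\<zeta> * of_real s) * of_real (weight s) - ?P s
       = (exp (\<zeta> * of_real s) - (\<Sum>k\<le>n. (\<zeta> * of_real s) ^ k / fact k)) * of_real (weight s)"
      by (simp add: algebra_simps)
    also have "norm \<dots> \<le> (exp (4 * norm (\<zeta> * of_real s)) / 2 ^ n) * exp (2 * s)"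
      by (subst norm_mult, rule mult_mono[OF exp_truncation_bound])
         (use s weight_le[of s] weight_pos[of s] in auto)
    also have "\<dots> = exp ((4 * norm \<zeta> + 2) * s) / 2 ^ n"
      using s by (simp add: norm_mult exp_add[symmetric] algebra_simps)
    also have "\<dots> \<le> exp ((4 * R + 2) * T) / 2 ^ n"
      using s assms R by (intro divide_right_mono) (auto intro!: mult_mono)
    finally show "norm (exp (\<zeta> * of_real s) * of_real (weight s) - ?P s) \<le> exp ((4 * R + 2) * T) / 2 ^ n" .
  qed
  then show ?thesis using assms(1) by (simp add: mult.commute)
qed

text \<open>The threshold comes from 4 (4R + 3) exp (R + 3) <= exp 2 * exp (4R + 2) * exp (R + 3) =
  exp (5R + 7). That a degree exponential in \<open>R\<close> suffices is the source of the
  logarithm in the theorem.\<close>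

lemma truncation_degree:
  assumes "0 \<le> R" "T = 2 * exp (R + 3)" "exp (5 * R + 7) \<le> real n"
  shows "T * exp ((4 * R + 2) * T) / 2 ^ n \<le> (1 :: real)"
proof -
  have T: "0 < T" using assms by simp
  have e2: "4 \<le> exp (2 :: real)" using exp_lower_Taylor_quadratic[of 2] by simp
  have "2 * (T + (4 * R + 2) * T) = 4 * ((4 * R + 3) * exp (R + 3))" using assms(2) by (simp add: algebra_simps)
  also have "\<dots> \<le> exp 2 * (exp (4 * R + 2) * exp (R + 3))"
    using e2 assms(1) exp_ge_add_one_self[of "4 * R + 2"] by (intro mult_mono) auto
  also have "\<dots> = exp (5 * R + 7)" by (simp add: exp_add[symmetric])
  finally have n: "T + (4 * R + 2) * T \<le> real n / 2" using assms(3) by simp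
  have "T * exp ((4 * R + 2) * T) \<le> exp T * exp ((4 * R + 2) * T)"
    using exp_ge_add_one_self[of T] by (intro mult_right_mono) (linarith, simp)
  also have "\<dots> \<le> exp (real n / 2)" using n by (simp add: exp_add[symmetric])
  also have "\<dots> = exp (1 / 2) ^ n" by (simp add: exp_of_nat_mult[symmetric])
  also have "\<dots> \<le> 2 ^ n" using exp_half_le2 by (intro power_mono) auto
  finally show ?thesis by simp
qed

text \<open>Take the Taylor polynomial and drop its constant term \<open>rotint T 0\<close>, whose
  real part is at least 4. Off the half-strip the real part is then at most 2 + 1 - 4 = -1.\<close>

lemma polynomial_negative_off_half_strip:
  assumes "0 \<le> R" "exp (5 * R + 7) \<le> real n"
  shows "\<exists>q :: nat \<Rightarrow> complex. q 0 = 0 \<and> (\<forall>\<zeta>. norm \<zeta> \<le> R \<longrightarrow> Re \<zeta> \<le> - 3 \<or> 3 \<le> \<bar>Im \<zeta>\<bar> \<longrightarrow>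
            Re (\<Sum>k\<le>n. q k * \<zeta> ^ k) \<le> - 1)"
proof -
  define T where "T = 2 * exp (R + 3)"
  define q where "q = (\<lambda>k. integral {0..T} (\<lambda>s. complex_of_real (s ^ k * weight s)) / fact k)"
  have T4: "4 \<le> T" using assms(1) exp_ge_add_one_self[of "R + 3"] unfolding T_def by linarith
  have q0: "q 0 = rotint T 0" by (simp add: q_def rotint_def)
  have "Re (\<Sum>k\<le>n. (q(0 := 0)) k * \<zeta> ^ k) \<le> - 1"
    if "norm \<zeta> \<le> R" "Re \<zeta> \<le> - 3 \<or> 3 \<le> \<bar>Im \<zeta>\<bar>" for \<zeta>
  proof -
    have "(\<Sum>k\<le>n. q k * \<zeta> ^ k) = (\<Sum>k\<le>n. (q(0 := 0)) k * \<zeta> ^ k) + q 0"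
      by (simp add: sum.atMost_shift)
    moreover have "norm (rotint T \<zeta> - (\<Sum>k\<le>n. q k * \<zeta> ^ k)) \<le> 1"
      using order_trans[OF rotint_truncation truncation_degree[OF assms(1) T_def assms(2)], of \<zeta>] T4 that
      unfolding q_def by simp
    moreover have "norm (rotint T \<zeta>) \<le> 2" using rotint_outside[OF assms(1) T_def] that by blast
    moreover have "4 \<le> Re (q 0)" using rotint_0[OF T4] q0 by simp
    ultimately show ?thesis
      using abs_Re_le_cmod[of "rotint T \<zeta> - (\<Sum>k\<le>n. q k * \<zeta> ^ k)"] abs_Re_le_cmod[of "rotint T \<zeta>"]
      by simp
  qed
  then show ?thesis by (intro exI[of _ "q(0 := 0)"]) auto
qed


subsection \<open>Polynomials as sums of powers of linear functions\<close>

text \<open>Orthogonality of characters: the summands are powers of a root of unity x of order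
  dividing n + 1. As |k - m| < n + 1, x is 1 only for k = m; otherwise the geometric sum
  vanishes.\<close>

lemma sum_roots_of_unity:
  fixes k m n :: nat
  assumes "k \<le> n" "m \<le> n"
  defines "w \<equiv> \<lambda>j. cis (2 * pi * real j / real (Suc n))"
  shows "(\<Sum>j\<le>n. w j ^ k / w j ^ m) = (if k = m then of_nat (Suc n) else 0)"
proof (cases "k = m")
  case True
  then show ?thesis by (simp add: w_def)
next
  case False
  define x where "x = cis (2 * pi * (real k - real m) / real (Suc n))"
  have 1: "w j ^ k / w j ^ m = x ^ j" for j
    unfolding w_def x_def Complex.DeMoivre cis_divide by (rule arg_cong[where f = cis]) (simp add: algebra_simps diff_divide_distrib del: of_nat_Suc)
  have "x \<noteq> 1"
  proof
    assume "x = 1"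
    then have "cos (2 * pi * (real k - real m) / real (Suc n)) = 1" by (simp add: x_def cis.ctr complex_eq_iff)
    then obtain i :: int where "2 * pi * (real k - real m) / real (Suc n) = of_int i * 2 * pi"
      using cos_one_2pi_int by metis
    then have "2 * pi * (real k - real m) = 2 * pi * (of_int i * real (Suc n))" by (simp add: field_simps)
    then have "real k - real m = of_int i * real (Suc n)"
      unfolding mult_cancel_left by simp
    then have eq: "int k - int m = i * int (Suc n)"
      by (metis (mono_tags, opaque_lifting) of_int_diff of_int_eq_iff of_int_mult of_int_of_nat_eq)
    then have "i \<noteq> 0" using False by auto
    then have "\<bar>i\<bar> * int (Suc n) \<ge> 1 * int (Suc n)" by (intro mult_right_mono) auto
    then have "\<bar>int k - int m\<bar> \<ge> int (Suc n)" unfolding eq by (simp add: abs_mult)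
    then show False using assms by linarith
  qed
  moreover have "x ^ Suc n = 1"
  proof -
    have "x ^ Suc n = cis (2 * pi * (real k - real m))" by (simp add: x_def Complex.DeMoivre del: power_Suc of_nat_Suc)
    also have "\<dots> = cis (2 * pi * of_int (int k - int m))" by simp
    also have "\<dots> = 1" by (rule cis_multiple_2pi) simp
    finally show ?thesis .
  qed
  ultimately have "(\<Sum>j\<le>n. x ^ j) = 0"
    by (simp add: lessThan_Suc_atMost[symmetric] geometric_sum del: sum.lessThan_Suc power_Suc)
  then show ?thesis using False 1 by simp
qed

text \<open>The coefficient of \<open>\<zeta> ^ k\<close> in \<open>(1 + w j * \<zeta>) ^ n\<close>
  is a nonzero binomial coefficient times \<open>w j ^ k\<close>. With the (n + 1)-st roots of unity
  as \<open>w j\<close>, a discrete Fourier inversion recovers any prescribed coefficients.\<close>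

lemma polynomial_as_sum_of_powers:
  fixes q :: "nat \<Rightarrow> complex"
  shows "\<exists>c w. (\<forall>j. norm (w j) = 1) \<and>
           (\<forall>\<zeta>. (\<Sum>k\<le>n. q k * \<zeta> ^ k) = (\<Sum>j\<le>n. c j * (1 + w j * \<zeta>) ^ n))"
proof -
  define w where "w = (\<lambda>j. cis (2 * pi * real j / real (Suc n)))"
  \<comment> \<open>The inverse Fourier transform of \<open>q m\<close> divided by the binomial
    coefficient \<open>n choose m\<close>.\<close>
  define c where "c = (\<lambda>j. \<Sum>m\<le>n. q m / (of_nat (Suc n) * of_nat (n choose m) * w j ^ m))"
  have "(\<Sum>j\<le>n. c j * (1 + w j * \<zeta>) ^ n) = (\<Sum>k\<le>n. q k * \<zeta> ^ k)" for \<zeta>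
  proof -
    have bin: "(1 + w j * \<zeta>) ^ n = (\<Sum>k\<le>n. of_nat (n choose k) * w j ^ k * \<zeta> ^ k)" for j
      by (subst add.commute, subst binomial_ring) (simp add: power_mult_distrib mult.assoc)
    have "(\<Sum>j\<le>n. c j * (1 + w j * \<zeta>) ^ n) = (\<Sum>j\<le>n. \<Sum>m\<le>n. \<Sum>k\<le>n.
        q m / (of_nat (Suc n) * of_nat (n choose m)) * of_nat (n choose k) * \<zeta> ^ k * (w j ^ k / w j ^ m))"
      unfolding bin c_def sum_product by (intro sum.cong) (simp_all add: mult_ac)
    also have "\<dots> = (\<Sum>m\<le>n. \<Sum>k\<le>n. \<Sum>j\<le>n.
        q m / (of_nat (Suc n) * of_nat (n choose m)) * of_nat (n choose k) * \<zeta> ^ k * (w j ^ k / w j ^ m))"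
      by (subst sum.swap) (intro sum.cong refl sum.swap)
    also have "\<dots> = (\<Sum>m\<le>n. \<Sum>k\<le>n. q m / (of_nat (Suc n) * of_nat (n choose m)) * of_nat (n choose k) *
        \<zeta> ^ k * (if k = m then of_nat (Suc n) else 0))"
      unfolding w_def sum_distrib_left[symmetric]
      by (intro sum.cong refl arg_cong2[where f = "(*)"] sum_roots_of_unity) auto
    also have "\<dots> = (\<Sum>m\<le>n. q m * \<zeta> ^ m)"
      by (intro sum.cong refl) (simp add: if_distrib[of "\<lambda>x. _ * x"] sum.delta binomial_eq_0_iff
          del: of_nat_Suc cong: if_cong)
    finally show ?thesis .
  qed
  then show ?thesis by (intro exI[of _ c] exI[of _ w]) (auto simp: w_def)
qed


subsection \<open>Spherical harmonics as powers of isotropic linear forms\<close>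

definition clin :: "complex \<times> complex \<times> complex \<Rightarrow> real ^ 3 \<Rightarrow> complex" where
  "clin = (\<lambda>(a, b, c) p. a * of_real (p $ 1) + b * of_real (p $ 2) + c * of_real (p $ 3))"

lemma clin_linear: "linear (clin z)"
  by (cases z) (auto intro!: linearI simp: clin_def algebra_simps scaleR_conv_of_real[where 'a = complex])

lemma clin_has_derivative [derivative_intros]: "(clin z has_derivative clin z) F"
  by (simp add: bounded_linear_imp_has_derivative linear_conv_bounded_linear[symmetric] clin_linear)

text \<open>For isotropic \<open>z j\<close> (that is, \<open>a\<^sup>2 + b\<^sup>2 + c\<^sup>2 = 0\<close>) these are harmonic homogeneous polynomials.\<close>

definition power_comb :: "'j set \<Rightarrow> ('j \<Rightarrow> complex) \<Rightarrow> ('j \<Rightarrow> complex \<times> complex \<times> complex) \<Rightarrow> nat \<Rightarrow> real ^ 3 \<Rightarrow> real" where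
  "power_comb J c z n p = Re (\<Sum>j\<in>J. c j * clin (z j) p ^ n)"

text \<open>The factor \<open>clin (z j) h\<close> goes into the coefficients, so the class is
  closed under directional derivatives. For n = 0 the coefficient \<open>of_nat n\<close> vanishes,
  which makes the truncated exponent \<open>n - 1\<close> harmless.\<close>

lemma power_comb_has_derivative:
  "(power_comb J c z n has_derivative
     (\<lambda>h. power_comb J (\<lambda>j. c j * of_nat n * clin (z j) h) z (n - 1) p)) (at p within S)"
  unfolding power_comb_def
  by (rule has_derivative_Re derivative_eq_intros refl)+
     (simp add: mult_ac)

lemma power_comb_Ck_on: "Ck_on k UNIV (power_comb J c z n)"
proof (induction k arbitrary: c n)
  case 0
  show ?case
    by (simp add: continuous_on_eq_continuous_within)
       (meson has_derivative_continuous power_comb_has_derivative)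
next
  case (Suc k)
  have "frechet_derivative (power_comb J c z n) (at p)
      = (\<lambda>h. power_comb J (\<lambda>j. c j * of_nat n * clin (z j) h) z (n - 1) p)" for p
    by (rule frechet_derivative_at[OF power_comb_has_derivative, symmetric])
  moreover have "power_comb J c z n differentiable_on UNIV"
    unfolding differentiable_on_def differentiable_def using power_comb_has_derivative by blast
  ultimately show ?case using Suc by simp
qed

lemma power_comb_smooth: "smooth_on_sphere (power_comb J c z n)"
  unfolding smooth_on_sphere_def using power_comb_Ck_on by blast

text \<open>Compose with the great circle through \<open>p\<close> in direction \<open>u\<close>.\<close>

lemma sphere_derivative_unique:
  fixes f :: "real ^ 3 \<Rightarrow> 'b :: real_normed_vector"
  assumes D: "(f has_derivative D) (at p within S2)" "(f has_derivative D') (at p within S2)"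
    and p: "p \<in> S2" and u: "u \<bullet> p = 0" "norm u = 1"
  shows "D u = D' u"
proof -
  define g where "g = (\<lambda>t. cos t *\<^sub>R p + sin t *\<^sub>R u)"
  have pp: "p \<bullet> p = 1" "u \<bullet> u = 1" "p \<bullet> u = 0" using p u by (auto simp: norm_eq_1 inner_commute)
  have S: "g t \<in> S2" for t
  proof -
    have "g t \<bullet> g t = (cos t)\<^sup>2 + (sin t)\<^sup>2"
      by (simp add: g_def inner_add_left inner_add_right pp u power2_eq_square)
    then show ?thesis by (simp add: norm_eq_1)
  qed
  have g: "(g has_derivative (\<lambda>t. t *\<^sub>R u)) (at 0)"
    unfolding g_def by (auto intro!: derivative_eq_intros)
  have g0: "g 0 = p" by (simp add: g_def)
  have "((\<lambda>t. f (g t)) has_derivative (\<lambda>t. L (t *\<^sub>R u))) (at 0)"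
    if "(f has_derivative L) (at p within S2)" for L
    by (rule has_derivative_in_compose[OF g], rule has_derivative_subset[where s = S2])
       (use S g0 that in auto)
  from this[OF D(1)] this[OF D(2)] have "(\<lambda>t. D (t *\<^sub>R u)) = (\<lambda>t. D' (t *\<^sub>R u))"
    by (rule has_derivative_unique)
  then show ?thesis by (metis scaleR_one)
qed

section \<open>Gradient and Laplacian on the sphere\<close>

text \<open>On the sphere, f agrees with f - (G . p) / 2 * (|q|^2 - 1), whose Euclidean gradient at
  \<open>p\<close> is already tangent. For uniqueness, two candidates are compared in the direction
  of their difference.\<close>

lemma sphere_grad_eq:
  assumes f: "(f has_derivative (\<lambda>h. G \<bullet> h)) (at p)" and p: "p \<in> S2"
  shows "sphere_grad f p = G - (G \<bullet> p) *\<^sub>R p"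
  unfolding sphere_grad_def
proof (rule the_equality)
  let ?g = "G - (G \<bullet> p) *\<^sub>R p"
  have pp: "p \<bullet> p = 1" using p by (simp add: norm_eq_1)
  have f': "(f has_derivative (\<lambda>h. G \<bullet> h)) (at p within S2)" using f has_derivative_at_withinI by blast
  have "((\<lambda>q. q \<bullet> q) has_derivative (\<lambda>h. 2 * (p \<bullet> h))) (at p within S2)"
    by (auto intro!: derivative_eq_intros simp: inner_commute)
  then have "((\<lambda>q. f q - (G \<bullet> p) / 2 * (q \<bullet> q)) has_derivative (\<lambda>h. G \<bullet> h - (G \<bullet> p) / 2 * (2 * (p \<bullet> h)))) (at p within S2)"
    by (intro has_derivative_diff f' has_derivative_mult_right)
  then have "((\<lambda>q. f q - (G \<bullet> p) / 2) has_derivative (\<lambda>h. ?g \<bullet> h)) (at p within S2)"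
    by (rule has_derivative_transform[rotated 2, THEN has_derivative_eq_rhs])
       (use p in \<open>auto simp: norm_eq_1 inner_diff_left\<close>)
  from has_derivative_add[OF this has_derivative_const[of "(G \<bullet> p) / 2"]]
  have "(f has_derivative (\<lambda>h. ?g \<bullet> h)) (at p within S2)" by simp
  moreover have tang: "?g \<bullet> p = 0" using pp by (simp add: inner_diff_left)
  ultimately show g: "?g \<bullet> p = 0 \<and> (f has_derivative (\<lambda>h. ?g \<bullet> h)) (at p within S2)" by simp
  fix g assume *: "g \<bullet> p = 0 \<and> (f has_derivative (\<lambda>h. g \<bullet> h)) (at p within S2)"
  define d where "d = g - ?g"
  have dp: "d \<bullet> p = 0" using * tang by (simp add: d_def inner_diff_left)
  show "g = ?g"
  proof (rule ccontr)
    assume "g \<noteq> ?g"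
    then have "norm d \<noteq> 0" by (simp add: d_def)
    have "(\<lambda>h. g \<bullet> h) (sgn d) = (\<lambda>h. ?g \<bullet> h) (sgn d)"
    proof (rule sphere_derivative_unique)
      show "(f has_derivative (\<lambda>h. g \<bullet> h)) (at p within S2)" using * by blast
      show "(f has_derivative (\<lambda>h. ?g \<bullet> h)) (at p within S2)" using g by blast
      show "sgn d \<bullet> p = 0" using dp by (simp add: sgn_div_norm)
      show "norm (sgn d) = 1" using \<open>norm d \<noteq> 0\<close> by (simp add: norm_sgn)
    qed (rule p)
    then have "d \<bullet> sgn d = 0" by (simp add: d_def inner_diff_left)
    then show False using \<open>norm d \<noteq> 0\<close> by (simp add: sgn_div_norm)
  qed
qed

text \<open>Rotation invariance of the sum of squares: the matrix with rows u, v, p is orthogonal,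
  so its columns are orthonormal too.\<close>

lemma clin_isotropic:
  assumes "norm u = 1" "norm v = 1" "norm p = 1" "u \<bullet> v = 0" "u \<bullet> p = 0" "v \<bullet> p = 0"
  shows "(clin (a, b, c) u)\<^sup>2 + (clin (a, b, c) v)\<^sup>2 + (clin (a, b, c) p)\<^sup>2 = a\<^sup>2 + b\<^sup>2 + c\<^sup>2"
proof -
  define M :: "real ^ 3 ^ 3" where "M = vector [u, v, p]"
  have rows: "M $ 1 = u" "M $ 2 = v" "M $ 3 = p" by (simp_all add: M_def)
  have "M ** transpose M = mat 1"
    using assms by (simp add: vec_eq_iff matrix_matrix_mult_def transpose_def mat_def forall_3 rows
        norm_eq_1 inner_vec_def sum_3 mult.commute)
  then have "transpose M ** M = mat 1" using matrix_left_right_inverse by blast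
  then have *: "\<And>i j. u $ i * u $ j + v $ i * v $ j + p $ i * p $ j = (if i = j then 1 else 0)"
    by (simp add: vec_eq_iff matrix_matrix_mult_def transpose_def mat_def sum_3 rows)
  have **: "complex_of_real (u $ i) * u $ j + v $ i * v $ j + p $ i * p $ j = (if i = j then 1 else 0)" for i j
    using arg_cong[OF *[of i j], of complex_of_real] by (cases "i = j") auto
  have "(clin (a, b, c) u)\<^sup>2 + (clin (a, b, c) v)\<^sup>2 + (clin (a, b, c) p)\<^sup>2
     = a\<^sup>2 * (complex_of_real (u $ 1) * u $ 1 + v $ 1 * v $ 1 + p $ 1 * p $ 1)
     + b\<^sup>2 * (complex_of_real (u $ 2) * u $ 2 + v $ 2 * v $ 2 + p $ 2 * p $ 2)
     + c\<^sup>2 * (complex_of_real (u $ 3) * u $ 3 + v $ 3 * v $ 3 + p $ 3 * p $ 3)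
     + 2 * a * b * (complex_of_real (u $ 1) * u $ 2 + v $ 1 * v $ 2 + p $ 1 * p $ 2)
     + 2 * a * c * (complex_of_real (u $ 1) * u $ 3 + v $ 1 * v $ 3 + p $ 1 * p $ 3)
     + 2 * b * c * (complex_of_real (u $ 2) * u $ 3 + v $ 2 * v $ 3 + p $ 2 * p $ 3)"
    by (simp add: clin_def power2_eq_square algebra_simps)
  then show ?thesis unfolding ** by simp
qed

text \<open>Supplies the existence half of the definite description in
  \<open>sphere_div\<close>.\<close>

lemma tangent_basis_exists:
  assumes "p \<in> S2"
  obtains u v where "u \<bullet> p = 0" "v \<bullet> p = 0" "u \<bullet> v = 0" "norm u = 1" "norm v = 1"
proof -
  obtain w where w: "w \<noteq> 0" "orthogonal p w" using orthogonal_to_vector_exists[of p] by auto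
  define u where "u = sgn w"
  have u: "u \<bullet> p = 0" "norm u = 1"
    using w by (auto simp: u_def sgn_div_norm orthogonal_def inner_commute)
  have "(norm (cross3 p u))\<^sup>2 = 1" using norm_cross_dot[of p u] u assms by (simp add: inner_commute)
  then have "norm (cross3 p u) = 1" by (simp add: power2_eq_1_iff) (smt (verit) norm_ge_zero)
  with u that[of u "cross3 p u"] show thesis by (simp add: dot_cross_self)
qed

text \<open>The vector representing the functional \<open>h \<mapsto> power_comb J (\<lambda>j. d j
  * clin (z j) h) z m p\<close>. For \<open>d j = c j * of_nat n\<close> and
  \<open>m = n - 1\<close> it is the Euclidean gradient of
  \<open>power_comb J c z n\<close>.\<close>

definition power_comb_dual ::
  "'j set \<Rightarrow> ('j \<Rightarrow> complex) \<Rightarrow> ('j \<Rightarrow> complex \<times> complex \<times> complex) \<Rightarrow> nat \<Rightarrow> real ^ 3 \<Rightarrow> real ^ 3" where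
  "power_comb_dual J d z m p = (\<Sum>b\<in>Basis. power_comb J (\<lambda>j. d j * clin (z j) b) z m p *\<^sub>R b)"

lemma power_comb_dual_inner:
  "power_comb_dual J d z m p \<bullet> h = power_comb J (\<lambda>j. d j * clin (z j) h) z m p"
proof -
  define L where "L h = power_comb J (\<lambda>j. d j * clin (z j) h) z m p" for h
  have "linear L"
    by (rule linearI)
       (simp_all add: L_def power_comb_def linear_add[OF clin_linear] linear_scale[OF clin_linear]
         algebra_simps sum.distrib sum_distrib_left)
  then have "L h = (\<Sum>b\<in>Basis. (h \<bullet> b) *\<^sub>R L b)"
    using linear_sum[of L "\<lambda>b. (h \<bullet> b) *\<^sub>R b" Basis] linear_scale[of L]
    by (simp add: euclidean_representation)
  then show ?thesis
    by (simp add: L_def power_comb_dual_def inner_sum_left inner_commute[of h] mult.commute)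
qed

lemma power_comb_dual_has_derivative:
  "(power_comb_dual J d z m has_derivative
     (\<lambda>h. power_comb_dual J (\<lambda>j. d j * of_nat m * clin (z j) h) z (m - 1) p)) (at p within S)"
proof -
  have eq: "(\<lambda>j. d j * clin (z j) b * of_nat m * clin (z j) h) = (\<lambda>j. d j * of_nat m * clin (z j) h * clin (z j) b)" for b h
    by (simp add: mult_ac)
  have "(power_comb J (\<lambda>j. d j * clin (z j) b) z m has_derivative
     (\<lambda>h. power_comb J (\<lambda>j. d j * of_nat m * clin (z j) h * clin (z j) b) z (m - 1) p)) (at p within S)" for b
    using power_comb_has_derivative[of J "\<lambda>j. d j * clin (z j) b" z m p S] unfolding eq .
  then show ?thesis
    unfolding power_comb_dual_def by (intro has_derivative_sum has_derivative_scaleR_left)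
qed

text \<open>Euler's identity for homogeneous functions of degree n.\<close>

lemma power_comb_euler:
  "power_comb J (\<lambda>j. c j * of_nat n * clin (z j) p) z (n - 1) p = of_nat n * power_comb J c z n p"
proof (cases n)
  case (Suc m)
  have "(\<Sum>j\<in>J. c j * of_nat n * clin (z j) p * clin (z j) p ^ m) = of_nat n * (\<Sum>j\<in>J. c j * clin (z j) p ^ n)"
    by (simp add: Suc sum_distrib_left mult_ac)
  then have "Re (\<Sum>j\<in>J. c j * of_nat n * clin (z j) p * clin (z j) p ^ m) = of_nat n * Re (\<Sum>j\<in>J. c j * clin (z j) p ^ n)"
    by (simp del: of_nat_Suc)
  then show ?thesis by (simp add: power_comb_def Suc)
qed (simp add: power_comb_def)

lemma power_comb_sphere_grad:
  assumes "p \<in> S2"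
  shows "sphere_grad (power_comb J c z n) p
     = power_comb_dual J (\<lambda>j. c j * of_nat n) z (n - 1) p - (of_nat n * power_comb J c z n p) *\<^sub>R p"
proof -
  have "(power_comb J c z n has_derivative (\<lambda>h. power_comb_dual J (\<lambda>j. c j * of_nat n) z (n - 1) p \<bullet> h)) (at p)"
    unfolding power_comb_dual_inner by (rule power_comb_has_derivative)
  from sphere_grad_eq[OF this assms] show ?thesis by (simp only: power_comb_dual_inner power_comb_euler)
qed

text \<open>By isotropy the Euclidean Hessian H has trace 0, so its trace over the tangent plane is
  -H(p, p), which is -n (n - 1) f by Euler's identity used twice. Removing the normal part of the
  gradient costs n f in each of the two tangent directions: -n (n - 1) - 2n = -n (n + 1).\<close>

lemma power_comb_laplacian:
  assumes p: "p \<in> S2" and iso: "\<And>j. j \<in> J \<Longrightarrow> (\<lambda>(a, b, c). a\<^sup>2 + b\<^sup>2 + c\<^sup>2) (z j) = 0"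
  shows "sphere_laplacian (power_comb J c z n) p = - (real n * (real n + 1)) * power_comb J c z n p"
  unfolding sphere_laplacian_def sphere_div_def
proof (rule the_equality)
  let ?f = "power_comb J c z n"
  let ?H = "\<lambda>h k. power_comb J (\<lambda>j. c j * of_nat n * of_nat (n - 1) * clin (z j) h * clin (z j) k) z (n - 1 - 1) p"
  \<comment> \<open>The product rule applied to the tangential gradient; the multiple of
    \<open>p\<close> drops out against tangent vectors.\<close>
  define X where "X h = power_comb_dual J (\<lambda>j. c j * of_nat n * of_nat (n - 1) * clin (z j) h) z (n - 1 - 1) p
     - ((of_nat n * ?f p) *\<^sub>R h
        + (of_nat n * power_comb J (\<lambda>j. c j * of_nat n * clin (z j) h) z (n - 1) p) *\<^sub>R p)" for h
  have "((\<lambda>p. power_comb_dual J (\<lambda>j. c j * of_nat n) z (n - 1) p - (of_nat n * ?f p) *\<^sub>R p) has_derivative X)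
      (at p within S2)"
    unfolding X_def
    by (intro has_derivative_diff power_comb_dual_has_derivative has_derivative_scaleR
        has_derivative_mult_right power_comb_has_derivative has_derivative_ident)
  then have X: "(sphere_grad ?f has_derivative X) (at p within S2)"
    using p by (rule has_derivative_transform[rotated 2]) (simp_all only: power_comb_sphere_grad)
  have trace: "X u \<bullet> u + X v \<bullet> v = - (real n * (real n + 1)) * ?f p"
    if uv: "u \<bullet> p = 0" "v \<bullet> p = 0" "u \<bullet> v = 0" "norm u = 1" "norm v = 1" for u v
  proof -
    have "clin (z j) u * clin (z j) u + clin (z j) v * clin (z j) v + clin (z j) p * clin (z j) p = 0" if "j \<in> J" for j
      using clin_isotropic[of u v p] iso[OF that] uv p by (cases "z j") (auto simp: power2_eq_square)
    then have "clin (z j) u * clin (z j) u + clin (z j) v * clin (z j) v = - (clin (z j) p * clin (z j) p)" if "j \<in> J" for j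
      using that by (simp add: eq_neg_iff_add_eq_0)
    moreover have "a * x * x * q + a * y * y * q = - (a * w * w * q)" if "x * x + y * y = - (w * w)"
      for a q x y w :: complex
    proof -
      have "a * x * x * q + a * y * y * q = a * (x * x + y * y) * q" by (simp add: algebra_simps)
      then show ?thesis by (simp add: that)
    qed
    ultimately have sum: "?H u u + ?H v v = - ?H p p"
      unfolding power_comb_def plus_complex.sel[symmetric] uminus_complex.sel[symmetric]
        sum.distrib[symmetric] sum_negf[symmetric]
      by (intro arg_cong[where f = Re] sum.cong refl) blast
    have Hp: "?H p p = real n * (real n - 1) * ?f p"
    proof -
      have "?H p p = power_comb J (\<lambda>j. c j * of_nat n * clin (z j) p * of_nat (n - 1) * clin (z j) p) z (n - 1 - 1) p"
        by (simp only: mult_ac)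
      also have "\<dots> = real (n - 1) * (real n * ?f p)" by (simp only: power_comb_euler)
      finally show ?thesis by (cases n) simp_all
    qed
    have Xh: "X h \<bullet> h = ?H h h - real n * ?f p" if "h \<bullet> p = 0" "norm h = 1" for h
      using that unfolding X_def inner_diff_left inner_add_left power_comb_dual_inner
      by (simp add: norm_eq_1 inner_commute)
    have "X u \<bullet> u + X v \<bullet> v = (?H u u + ?H v v) - 2 * (real n * ?f p)"
      using Xh uv by simp
    also have "\<dots> = - (real n * (real n + 1)) * ?f p"
      unfolding sum Hp by (simp add: algebra_simps)
    finally show ?thesis .
  qed
  obtain u v where "u \<bullet> p = 0" "v \<bullet> p = 0" "u \<bullet> v = 0" "norm u = 1" "norm v = 1"
    using tangent_basis_exists[OF p] .
  then show "\<exists>X' u v. (sphere_grad ?f has_derivative X') (at p within S2) \<and>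
        u \<bullet> p = 0 \<and> v \<bullet> p = 0 \<and> u \<bullet> v = 0 \<and> norm u = 1 \<and> norm v = 1 \<and>
        - (real n * (real n + 1)) * ?f p = X' u \<bullet> u + X' v \<bullet> v"
    using X trace by metis
  fix d assume "\<exists>X' u v. (sphere_grad ?f has_derivative X') (at p within S2) \<and>
        u \<bullet> p = 0 \<and> v \<bullet> p = 0 \<and> u \<bullet> v = 0 \<and> norm u = 1 \<and> norm v = 1 \<and>
        d = X' u \<bullet> u + X' v \<bullet> v"
  then obtain X' u v where X': "(sphere_grad ?f has_derivative X') (at p within S2)"
    and uv: "u \<bullet> p = 0" "v \<bullet> p = 0" "u \<bullet> v = 0" "norm u = 1" "norm v = 1"
    and d: "d = X' u \<bullet> u + X' v \<bullet> v" by blast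
  \<comment> \<open>Another derivative within the sphere may differ from \<open>X\<close> off the
    tangent plane, but not on it.\<close>
  have "X' u = X u" "X' v = X v"
    using uv by (auto intro!: sphere_derivative_unique[OF X' X p])
  then show "d = - (real n * (real n + 1)) * ?f p" using d trace[OF uv] by simp
qed

lemma power_comb_eigenfunction:
  assumes "\<And>j. j \<in> J \<Longrightarrow> (\<lambda>(a, b, c). a\<^sup>2 + b\<^sup>2 + c\<^sup>2) (z j) = 0"
    and "p \<in> S2" "power_comb J c z n p \<noteq> 0"
  shows "sphere_eigenfunction (power_comb J c z n) (real n * (real n + 1))"
  unfolding sphere_eigenfunction_def
proof (intro conjI ballI)
  show "smooth_on_sphere (power_comb J c z n)" by (rule power_comb_smooth)
  show "\<exists>p\<in>S2. power_comb J c z n p \<noteq> 0" using assms(2,3) by blast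
  fix q assume "q \<in> S2"
  then have "sphere_laplacian (power_comb J c z n) q = - (real n * (real n + 1)) * power_comb J c z n q"
    using assms(1) by (rule power_comb_laplacian)
  then show "sphere_laplacian (power_comb J c z n) q + real n * (real n + 1) * power_comb J c z n q = 0"
    by simp
qed


subsection \<open>Area near an equatorial point\<close>

abbreviation coord_rect :: "(real \<times> real) set" where
  "coord_rect \<equiv> {0<..<pi} \<times> {0<..<2 * pi}"

lemma sphere_coords_nth [simp]:
  "sphere_coords (a, b) $ 1 = sin a * cos b"
  "sphere_coords (a, b) $ 2 = sin a * sin b"
  "sphere_coords (a, b) $ 3 = cos a"
  by (simp_all add: sphere_coords_def)

lemma norm_sphere_coords: "norm (sphere_coords x) = 1"
proof (cases x)
  case (Pair a b)
  have "(sin a * cos b)\<^sup>2 + (sin a * sin b)\<^sup>2 + (cos a)\<^sup>2 = (sin a)\<^sup>2 * ((sin b)\<^sup>2 + (cos b)\<^sup>2) + (cos a)\<^sup>2"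
    by (simp add: power_mult_distrib sin_squared_eq algebra_simps)
  also have "\<dots> = 1" by simp
  finally have "sphere_coords x \<bullet> sphere_coords x = 1"
    by (simp add: Pair inner_vec_def sum_3 power2_eq_square)
  then show ?thesis by (simp add: norm_eq_1)
qed

lemma continuous_on_sphere_coords: "continuous_on UNIV sphere_coords"
proof -
  have "continuous_on UNIV (\<lambda>x. sphere_coords x $ i)" for i
  proof -
    have "i = 1 \<or> i = 2 \<or> i = 3" using exhaust_3 by blast
    moreover have "(\<lambda>x. sphere_coords x $ 1) = (\<lambda>x. sin (fst x) * cos (snd x))"
      "(\<lambda>x. sphere_coords x $ 2) = (\<lambda>x. sin (fst x) * sin (snd x))"
      "(\<lambda>x. sphere_coords x $ 3) = (\<lambda>x. cos (fst x))"
      by (auto simp: fun_eq_iff)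
    ultimately show ?thesis by (elim disjE; simp only:; intro continuous_intros)
  qed
  then show ?thesis by (subst continuous_on_componentwise) (auto simp: Basis_vec_def inner_axis)
qed

lemma sphere_coords_measurable:
  "sphere_coords \<in> measurable (density (restrict_space lborel coord_rect) g) (restrict_space borel S2)"
proof -
  have "sphere_coords \<in> borel_measurable borel"
    by (intro borel_measurable_continuous_onI continuous_on_sphere_coords)
  then have "sphere_coords \<in> measurable lborel borel" by simp
  then have "sphere_coords \<in> measurable (restrict_space lborel coord_rect) borel"
    by (rule measurable_restrict_space1)
  then show ?thesis by (intro measurable_restrict_space2) (auto simp: norm_sphere_coords)
qed

lemma sphere_area_emeasure:
  assumes "A \<in> sets borel"
  shows "emeasure sphere_area (A \<inter> S2) =
     (\<integral>\<^sup>+x. ennreal (sin (fst x)) * indicator (coord_rect \<inter> sphere_coords -` A) x \<partial>lborel)"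
proof -
  have AS: "A \<inter> S2 \<in> sets (restrict_space borel S2)"
    using assms by (auto simp: sets_restrict_space)
  have Q: "coord_rect \<in> sets lborel" by (simp add: borel_open open_Times)
  have V: "sphere_coords -` (A \<inter> S2) \<inter> coord_rect \<in> sets (restrict_space lborel coord_rect)"
    using measurable_sets[OF sphere_coords_measurable[of "\<lambda>_. 1"] AS] by (simp add: space_restrict_space)
  have "(\<lambda>x :: real \<times> real. ennreal (sin (fst x))) \<in> borel_measurable borel"
    by (intro measurable_compose[OF _ measurable_ennreal] borel_measurable_continuous_onI continuous_intros)
  then have M: "(\<lambda>(\<theta>, \<phi>). ennreal (sin \<theta>)) \<in> borel_measurable (restrict_space lborel coord_rect)"
    by (intro measurable_restrict_space1) (simp add: split_beta')
  have "emeasure sphere_area (A \<inter> S2) =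
     emeasure (density (restrict_space lborel coord_rect) (\<lambda>(\<theta>, \<phi>). ennreal (sin \<theta>)))
       (sphere_coords -` (A \<inter> S2) \<inter> coord_rect)"
    unfolding sphere_area_def
    by (subst emeasure_distr[OF sphere_coords_measurable AS]) (simp add: space_restrict_space)
  also have "\<dots> = (\<integral>\<^sup>+x. ennreal (sin (fst x)) * indicator (sphere_coords -` (A \<inter> S2) \<inter> coord_rect) x
      \<partial>restrict_space lborel coord_rect)"
    by (subst emeasure_density[OF M V]) (simp add: split_beta)
  also have "\<dots> = (\<integral>\<^sup>+x. ennreal (sin (fst x)) * indicator (sphere_coords -` (A \<inter> S2) \<inter> coord_rect) x *
      indicator coord_rect x \<partial>lborel)"
    using Q by (subst nn_integral_restrict_space) auto
  also have "\<dots> = (\<integral>\<^sup>+x. ennreal (sin (fst x)) * indicator (coord_rect \<inter> sphere_coords -` A) x \<partial>lborel)"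
    by (intro nn_integral_cong) (auto simp: indicator_def norm_sphere_coords)
  finally show ?thesis .
qed

lemma emeasure_rect:
  fixes a b c d :: real
  assumes "a \<le> b" "c \<le> d"
  shows "emeasure lborel ({a..b} \<times> {c..d}) = ennreal ((b - a) * (d - c))"
proof -
  have "emeasure lborel ({a..b} \<times> {c..d}) = emeasure (lborel \<Otimes>\<^sub>M lborel) ({a..b} \<times> {c..d})"
    by (simp add: lborel_prod)
  also have "\<dots> = emeasure lborel {a..b} * emeasure lborel {c..d}"
    by (intro lborel.emeasure_pair_measure_Times) auto
  finally show ?thesis using assms by (simp add: ennreal_mult)
qed

text \<open>The area density sin is at most 1.\<close>

lemma sphere_area_le_rect:
  fixes a b c d :: real
  assumes A: "A \<in> sets borel" and "a \<le> b" "c \<le> d"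
    and sub: "coord_rect \<inter> sphere_coords -` A \<subseteq> {a..b} \<times> {c..d}"
  shows "measure sphere_area (A \<inter> S2) \<le> (b - a) * (d - c)"
proof -
  have "emeasure sphere_area (A \<inter> S2) \<le> (\<integral>\<^sup>+x. indicator ({a..b} \<times> {c..d}) x \<partial>lborel)"
    unfolding sphere_area_emeasure[OF A]
    using sub by (intro nn_integral_mono) (auto simp: indicator_def ennreal_le_1)
  also have "\<dots> = ennreal ((b - a) * (d - c))"
    using assms by (subst nn_integral_indicator) (auto simp: emeasure_rect borel_closed closed_Times)
  finally show ?thesis
    using assms by (simp add: measure_def enn2real_leI)
qed

lemma sphere_area_ge_rect:
  fixes a b c d s :: real
  assumes A: "A \<in> sets borel" and "a \<le> b" "c \<le> d" "0 \<le> s"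
    and sub: "{a..b} \<times> {c..d} \<subseteq> coord_rect \<inter> sphere_coords -` A"
    and s: "\<And>x. x \<in> {a..b} \<Longrightarrow> s \<le> sin x"
  shows "s * ((b - a) * (d - c)) \<le> measure sphere_area (A \<inter> S2)"
proof -
  have "ennreal (s * ((b - a) * (d - c))) = (\<integral>\<^sup>+x. ennreal s * indicator ({a..b} \<times> {c..d}) x \<partial>lborel)"
    using assms by (subst nn_integral_cmult_indicator) (auto simp: emeasure_rect ennreal_mult borel_closed closed_Times)
  also have "\<dots> \<le> emeasure sphere_area (A \<inter> S2)"
    unfolding sphere_area_emeasure[OF A]
    using sub s by (intro nn_integral_mono) (auto simp: indicator_def intro!: ennreal_leI)
  finally have *: "ennreal (s * ((b - a) * (d - c))) \<le> emeasure sphere_area (A \<inter> S2)" .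
  \<comment> \<open>\<open>measure\<close> sends an infinite value to 0, so the lower bound carries
    over only once finiteness is known.\<close>
  have "emeasure sphere_area (A \<inter> S2) \<le> (\<integral>\<^sup>+x. indicator ({0..pi} \<times> {0..2*pi}) x \<partial>lborel)"
    unfolding sphere_area_emeasure[OF A]
    by (intro nn_integral_mono) (auto simp: indicator_def ennreal_le_1)
  also have "\<dots> < \<infinity>"
    by (subst nn_integral_indicator) (auto simp: emeasure_rect borel_closed closed_Times)
  finally show ?thesis using * unfolding measure_def
    using assms(2-4) by (metis diff_ge_0_iff_ge enn2real_ennreal enn2real_mono infinity_ennreal_def mult_nonneg_nonneg)
qed

text \<open>Up to pi / 3 the cosine is at least 1 / 2 and the mean value theorem applies; beyond, 2
  sin x >= sqrt 3 >= 1.7 exceeds pi / 2. It turns a bound on |cos a| into one on |a - pi /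
  2|.\<close>

lemma abs_le_sin: "\<bar>x\<bar> \<le> 2 * \<bar>sin x\<bar>" if "\<bar>x\<bar> \<le> pi / 2" for x :: real
proof -
  have *: "x \<le> 2 * sin x" if "0 \<le> x" "x \<le> pi / 2" for x :: real
  proof (cases "x \<le> pi / 3")
    case True
    have "\<exists>y. 0 \<le> y \<and> y \<le> x \<and> sin x - sin 0 = (x - 0) * cos y"
    proof (cases "x = 0")
      case False
      then have "\<exists>y. 0 < y \<and> y < x \<and> sin x - sin 0 = (x - 0) * cos y"
        using \<open>0 \<le> x\<close> by (intro MVT2) (auto intro: derivative_eq_intros)
      then show ?thesis using less_imp_le by blast
    qed auto
    then obtain y where y: "0 \<le> y" "y \<le> x" "sin x = x * cos y" by auto
    have "cos (pi / 3) \<le> cos y" using y True by (intro cos_monotone_0_pi_le) auto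
    then have "x * (1 / 2) \<le> x * cos y" using that by (intro mult_left_mono) (auto simp: cos_60)
    then show ?thesis using y by simp
  next
    case False
    have "sin (pi / 3) \<le> sin x" using that False by (intro sin_monotone_2pi_le) auto
    moreover have "sqrt 3 \<ge> 17 / 10" by (rule real_le_rsqrt) (simp add: power2_eq_square)
    ultimately show ?thesis using that pi_approx by (simp add: sin_60)
  qed
  show ?thesis
  proof (cases "0 \<le> x")
    case True
    then show ?thesis using *[of x] that by simp
  next
    case False
    then show ?thesis using *[of "- x"] that by simp
  qed
qed

text \<open>The point \<open>\<theta> = pi / 2\<close>, \<open>\<phi> = pi\<close>, in the middle of the coordinate rectangle.\<close>

definition west :: "real ^ 3" where "west = vector [-1, 0, 0]"

lemma west_in_S2: "west \<in> S2"
  by (simp add: west_def norm_eq_1 inner_vec_def sum_3)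

lemma sphere_disc_west:
  assumes "0 < r" "r < pi"
  shows "sphere_disc west r = {p. cos r < - p $ 1} \<inter> S2"
proof -
  have "arccos (- p $ 1) < r \<longleftrightarrow> cos r < - p $ 1" if "p \<in> S2" for p
  proof -
    have "\<bar>p $ 1\<bar> \<le> 1" using component_le_norm_cart[of p 1] that by simp
    then have "arccos (- p $ 1) < arccos (cos r) \<longleftrightarrow> cos r < - p $ 1"
      by (intro arccos_less_mono) auto
    then show ?thesis using assms by (simp add: arccos_cos)
  qed
  then show ?thesis
    by (auto simp: sphere_disc_def sphere_dist_def west_def inner_vec_def sum_3)
qed

lemma borel_disc: "{p :: real ^ 3. cos r < - p $ 1} \<in> sets borel"
  by (intro borel_open open_Collect_less continuous_intros)

text \<open>The disc contains a coordinate square of side \<open>r / 2\<close> around \<open>\<theta> = pi / 2\<close>, \<open>\<phi> = pi\<close>.\<close>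

lemma sphere_disc_west_area_ge:
  assumes "0 < r" "r \<le> 1"
  shows "r\<^sup>2 / 8 \<le> measure sphere_area (sphere_disc west r)"
proof -
  have p3: "3 < pi" by (rule pi_gt3)
  have c: "1 / 2 \<le> cos x" if "\<bar>x\<bar> \<le> 1" for x :: real
  proof -
    have "cos (pi / 3) \<le> cos \<bar>x\<bar>" using that p3 by (intro cos_monotone_0_pi_le) auto
    then show ?thesis by (simp add: cos_60)
  qed
  have cs: "cos (r / 4) \<le> sin x" if "x \<in> {pi / 2 - r / 4..pi / 2 + r / 4}" for x
  proof -
    have "\<bar>x - pi / 2\<bar> \<le> r / 4" using that by (auto simp: abs_if)
    then have "cos (r / 4) \<le> cos \<bar>x - pi / 2\<bar>" using assms p3 by (intro cos_monotone_0_pi_le) auto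
    then show ?thesis by (simp add: cos_diff)
  qed
  have cc: "cos (r / 4) \<le> - cos x" if "x \<in> {pi - r / 4..pi + r / 4}" for x
  proof -
    have "\<bar>x - pi\<bar> \<le> r / 4" using that by (auto simp: abs_if)
    then have "cos (r / 4) \<le> cos \<bar>x - pi\<bar>" using assms p3 by (intro cos_monotone_0_pi_le) auto
    then show ?thesis by (simp add: cos_diff)
  qed
  \<comment> \<open>On the square the quantity to compare with \<open>cos r\<close> is
    \<open>sin x * (- cos y)\<close>, at least \<open>(cos (r / 4))\<^sup>2\<close>.\<close>
  have "cos r < cos (r / 2)" using assms p3 by (intro cos_monotone_0_pi) auto
  also have "\<dots> \<le> (cos (r / 4))\<^sup>2"
  proof -
    have "cos (r / 2) = 2 * (cos (r / 4))\<^sup>2 - 1" using cos_double_cos[of "r / 4"] by simp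
    moreover have "(cos (r / 4))\<^sup>2 \<le> 1" by (simp add: abs_square_le_1)
    ultimately show ?thesis by linarith
  qed
  finally have cr: "cos r < (cos (r / 4))\<^sup>2" .
  \<comment> \<open>Density at least 1 / 2 on a square of side r / 2 gives r^2 / 8.\<close>
  have "1 / 2 * ((pi / 2 + r / 4 - (pi / 2 - r / 4)) * (pi + r / 4 - (pi - r / 4)))
      \<le> measure sphere_area ({p. cos r < - p $ 1} \<inter> S2)"
  proof (rule sphere_area_ge_rect[OF borel_disc])
    show "{pi / 2 - r / 4..pi / 2 + r / 4} \<times> {pi - r / 4..pi + r / 4}
        \<subseteq> coord_rect \<inter> sphere_coords -` {p. cos r < - p $ 1}"
    proof (clarify, intro IntI)
      fix x y assume x: "x \<in> {pi / 2 - r / 4..pi / 2 + r / 4}" and y: "y \<in> {pi - r / 4..pi + r / 4}"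
      show "(x, y) \<in> coord_rect" using x y assms p3 by auto
      have "(cos (r / 4))\<^sup>2 \<le> sin x * (- cos y)"
        unfolding power2_eq_square using c[of "r / 4"] cs[OF x] cc[OF y] assms by (intro mult_mono) auto
      then show "(x, y) \<in> sphere_coords -` {p. cos r < - p $ 1}" using cr by simp
    qed
    show "1 / 2 \<le> sin x" if "x \<in> {pi / 2 - r / 4..pi / 2 + r / 4}" for x
      using cs[OF that] c[of "r / 4"] assms by simp
  qed (use assms in auto)
  then show ?thesis using assms p3 by (simp add: sphere_disc_west power2_eq_square algebra_simps)
qed

text \<open>In coordinates (a, b) the third component is cos a, so |a - pi / 2| <= 2
  \<open>\<delta>\<close>; and 0 < cos r < - sin a cos b <= - cos b forces |b - pi| < r. The
  rectangle has area \<open>4 * \<delta> * 2 * r\<close>.\<close>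

lemma sphere_strip_area_le:
  assumes "0 < r" "r \<le> 1" "0 \<le> \<delta>" "B \<in> sets borel"
    and B: "\<And>p. p \<in> S2 \<Longrightarrow> p \<in> B \<Longrightarrow> cos r < - p $ 1 \<and> \<bar>p $ 3\<bar> \<le> \<delta>"
  shows "measure sphere_area (B \<inter> S2) \<le> 8 * r * \<delta>"
proof -
  have "measure sphere_area (B \<inter> S2) \<le> (pi / 2 + 2 * \<delta> - (pi / 2 - 2 * \<delta>)) * (pi + r - (pi - r))"
  proof (rule sphere_area_le_rect)
    show "coord_rect \<inter> sphere_coords -` B \<subseteq> {pi / 2 - 2 * \<delta>..pi / 2 + 2 * \<delta>} \<times> {pi - r..pi + r}"
    proof
      fix x assume "x \<in> coord_rect \<inter> sphere_coords -` B"
      then obtain a b where x: "x = (a, b)" and ab: "a \<in> {0<..<pi}" "b \<in> {0<..<2 * pi}"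
        and "sphere_coords (a, b) \<in> B" by auto
      then have *: "cos r < - (sin a * cos b)" "\<bar>cos a\<bar> \<le> \<delta>"
        using B[of "sphere_coords (a, b)"] by (simp_all add: norm_sphere_coords)
      have "\<bar>a - pi / 2\<bar> \<le> 2 * \<bar>sin (a - pi / 2)\<bar>" using ab by (intro abs_le_sin) (auto simp: abs_if)
      also have "\<dots> \<le> 2 * \<delta>" using * by (simp add: sin_diff)
      finally have 1: "\<bar>a - pi / 2\<bar> \<le> 2 * \<delta>" .
      have "0 < cos r" using assms pi_gt3 by (intro cos_gt_zero) auto
      moreover have s: "0 < sin a" "sin a \<le> 1" using ab by (auto intro: sin_gt_zero)
      ultimately have "0 < - cos b" using * by (smt (verit) mult_nonneg_nonneg mult_minus_right)
      then have "sin a * (- cos b) \<le> 1 * (- cos b)" using s by (intro mult_right_mono) auto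
      then have "cos r < cos \<bar>b - pi\<bar>" using * by (simp add: cos_diff)
      moreover have "\<bar>b - pi\<bar> \<le> pi" using ab by (auto simp: abs_if)
      ultimately have "\<bar>b - pi\<bar> < r"
        using assms \<open>\<bar>b - pi\<bar> \<le> pi\<close> cos_monotone_0_pi_le[of r "\<bar>b - pi\<bar>"] by (cases "\<bar>b - pi\<bar> < r") (auto simp del: cos_abs_real)
      then show "x \<in> {pi / 2 - 2 * \<delta>..pi / 2 + 2 * \<delta>} \<times> {pi - r..pi + r}" using 1 unfolding x by (auto simp: abs_le_iff)
    qed
  qed (use assms in auto)
  then show ?thesis by (simp add: algebra_simps)
qed


subsection \<open>Local limits of spherical harmonics\<close>

lemma norm_power_diff_le:
  fixes x y :: complex
  assumes "norm x \<le> M" "norm y \<le> M" "1 \<le> M"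
  shows "norm (x ^ n - y ^ n) \<le> real n * M ^ n * norm (x - y)"
proof (induction n)
  case (Suc n)
  have "norm (x ^ Suc n - y ^ Suc n) = norm (x * (x ^ n - y ^ n) + y ^ n * (x - y))"
    by (simp add: algebra_simps)
  also have "\<dots> \<le> norm x * norm (x ^ n - y ^ n) + norm y ^ n * norm (x - y)"
    by (metis norm_mult norm_power norm_triangle_ineq)
  also have "\<dots> \<le> M * (real n * M ^ n * norm (x - y)) + M ^ Suc n * norm (x - y)"
  proof (intro add_mono mult_mono Suc.IH)
    have "norm y ^ n \<le> M ^ n" using assms by (intro power_mono) auto
    also have "\<dots> \<le> M ^ Suc n" using assms by (intro power_increasing) auto
    finally show "norm y ^ n \<le> M ^ Suc n" .
  qed (use assms in auto)
  also have "\<dots> = real (Suc n) * M ^ Suc n * norm (x - y)" by (simp add: algebra_simps)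
  finally show ?case .
qed simp

text \<open>At (x, y, z) the form is -x + a (y + i z) - (y - i z) / (4a). The last coefficient makes
  the squares sum to 0, and the form equals 1 at \<open>west\<close> for every a.\<close>

definition isotropic :: "complex \<Rightarrow> complex \<times> complex \<times> complex" where
  "isotropic a = (- 1, a - 1 / (4 * a), \<i> * (a + 1 / (4 * a)))"

lemma isotropic_squares: "a \<noteq> 0 \<Longrightarrow> (\<lambda>(a, b, c). a\<^sup>2 + b\<^sup>2 + c\<^sup>2) (isotropic a) = 0"
proof -
  assume "a \<noteq> 0"
  have *: "(- 1)\<^sup>2 + (a - b)\<^sup>2 + (\<i> * (a + b))\<^sup>2 = 1 - 4 * (a * b)" for b
    by (simp add: power2_eq_square algebra_simps)
  show ?thesis
    unfolding isotropic_def prod.case * using \<open>a \<noteq> 0\<close> by simp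
qed

text \<open>Orthogonal projection to the tangent plane at \<open>west\<close>, identified with the
  complex plane.\<close>

definition west_chart :: "real ^ 3 \<Rightarrow> complex" where
  "west_chart p = Complex (p $ 2) (p $ 3)"

lemma norm_west_chart:
  assumes "p \<in> S2"
  shows "(norm (west_chart p))\<^sup>2 = 1 - (p $ 1)\<^sup>2"
proof -
  have "p \<bullet> p = 1" using assms by (simp add: norm_eq_1)
  then have "(p $ 1)\<^sup>2 + (p $ 2)\<^sup>2 + (p $ 3)\<^sup>2 = 1" by (simp add: inner_vec_def sum_3 power2_eq_square)
  then show ?thesis unfolding west_chart_def cmod_power2 complex.sel by linarith
qed

text \<open>On the sphere near \<open>west\<close>, with \<open>\<zeta> = (y + \<i> z) / \<epsilon>\<close>, the linear form is
  \<open>- x + w \<zeta> - \<epsilon>\<^sup>2 cnj \<zeta> / (4 w)\<close>, and \<open>- x\<close> is close to \<open>1\<close>.\<close>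

lemma clin_isotropic_west:
  fixes w \<zeta> :: complex
  assumes w: "norm w = 1" and e: "0 < \<epsilon>" and p: "p \<in> S2" "p $ 1 \<le> 0"
    and chart: "west_chart p = of_real \<epsilon> * \<zeta>" and R: "norm \<zeta> \<le> R"
  shows "norm (clin (isotropic (w / of_real \<epsilon>)) p - (1 + w * \<zeta>)) \<le> \<epsilon>\<^sup>2 * (R\<^sup>2 + R)"
proof -
  have nz: "w \<noteq> 0" "complex_of_real \<epsilon> \<noteq> 0" using w e by auto
  have R0: "0 \<le> R" using R norm_ge_zero order_trans by blast
  have wc: "complex_of_real (p $ 2) + \<i> * complex_of_real (p $ 3) = of_real \<epsilon> * \<zeta>"
    unfolding chart[symmetric] by (simp add: west_chart_def complex_eq_iff)
  then have "cnj (complex_of_real (p $ 2) + \<i> * complex_of_real (p $ 3)) = cnj (of_real \<epsilon> * \<zeta>)" by simp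
  then have wcc: "complex_of_real (p $ 2) - \<i> * complex_of_real (p $ 3) = of_real \<epsilon> * cnj \<zeta>" by simp
  have "clin (isotropic (w / of_real \<epsilon>)) p = - of_real (p $ 1)
     + w / of_real \<epsilon> * (of_real (p $ 2) + \<i> * of_real (p $ 3))
     - of_real \<epsilon> / (4 * w) * (of_real (p $ 2) - \<i> * of_real (p $ 3))"
    by (simp add: clin_def isotropic_def algebra_simps)
  also have "\<dots> = - of_real (p $ 1) + w * \<zeta> - of_real (\<epsilon>\<^sup>2) / (4 * w) * cnj \<zeta>"
    unfolding wc wcc using nz by (simp add: power2_eq_square)
  finally have "clin (isotropic (w / of_real \<epsilon>)) p - (1 + w * \<zeta>)
     = of_real (- p $ 1 - 1) - of_real (\<epsilon>\<^sup>2) / (4 * w) * cnj \<zeta>" by (simp add: algebra_simps)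
  also have "norm \<dots> \<le> norm (complex_of_real (- p $ 1 - 1)) + norm (of_real (\<epsilon>\<^sup>2) / (4 * w) * cnj \<zeta>)"
    by (rule norm_triangle_ineq4)
  also have "norm (of_real (\<epsilon>\<^sup>2) / (4 * w) * cnj \<zeta>) = \<epsilon>\<^sup>2 * (norm \<zeta> / 4)"
    using w by (simp add: norm_mult norm_divide norm_power)
  \<comment> \<open>As \<open>- p $ 1\<close> lies in [0, 1], its distance to 1 is at most
    \<open>1 - (p $ 1)\<^sup>2\<close>, the squared modulus of the chart.\<close>
  also have "norm (complex_of_real (- p $ 1 - 1)) \<le> \<epsilon>\<^sup>2 * R\<^sup>2"
  proof -
    have s: "0 \<le> - p $ 1" "- p $ 1 \<le> 1" using component_le_norm_cart[of p 1] p by auto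
    have "(- p $ 1) * (- p $ 1) \<le> (- p $ 1) * 1" using s by (intro mult_left_mono)
    then have "norm (complex_of_real (- p $ 1 - 1)) \<le> 1 - (p $ 1)\<^sup>2"
      using s unfolding norm_of_real by (simp add: power2_eq_square)
    also have "\<dots> = \<epsilon>\<^sup>2 * (norm \<zeta>)\<^sup>2"
      using norm_west_chart[OF p(1)] unfolding chart by (simp add: norm_mult power_mult_distrib)
    also have "\<dots> \<le> \<epsilon>\<^sup>2 * R\<^sup>2" using R by (intro mult_left_mono power_mono) auto
    finally show ?thesis .
  qed
  also have "\<epsilon>\<^sup>2 * R\<^sup>2 + \<epsilon>\<^sup>2 * (norm \<zeta> / 4) \<le> \<epsilon>\<^sup>2 * (R\<^sup>2 + R)"
    unfolding distrib_left[symmetric] using R R0 by (intro mult_left_mono) auto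
  finally show ?thesis by simp
qed

text \<open>Each linear form is within \<open>\<epsilon>\<^sup>2 * (R\<^sup>2 + R)\<close> of
  \<open>1 + w j * \<zeta>\<close>, and both have modulus at most R + 2. Comparing n-th powers and
  summing over j gives an error of at most \<open>\<epsilon>\<^sup>2 * K\<close>.\<close>

lemma power_comb_local_model:
  fixes c w :: "nat \<Rightarrow> complex"
  assumes w: "\<And>j. norm (w j) = 1" and R: "0 \<le> R"
  shows "\<exists>\<epsilon>>0. \<epsilon> * R \<le> 1 \<and> (\<forall>p \<zeta>. p \<in> S2 \<longrightarrow> p $ 1 \<le> 0 \<longrightarrow> west_chart p = of_real \<epsilon> * \<zeta> \<longrightarrow> norm \<zeta> \<le> R \<longrightarrow>
     \<bar>power_comb {..n} c (\<lambda>j. isotropic (w j / of_real \<epsilon>)) n p - Re (\<Sum>j\<le>n. c j * (1 + w j * \<zeta>) ^ n)\<bar> \<le> 1 / 2)"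
proof -
  define K where "K = (\<Sum>j\<le>n. norm (c j)) * (real n * (R + 2) ^ n * (R\<^sup>2 + R))"
  \<comment> \<open>One choice that makes \<open>\<epsilon>\<close>, \<open>\<epsilon> * R\<close>
    and \<open>\<epsilon> * (R\<^sup>2 + R)\<close> at most 1 and \<open>\<epsilon> * K\<close> at
    most 1 / 2.\<close>
  define \<epsilon> where "\<epsilon> = 1 / (1 + R + R\<^sup>2 + 2 * K)"
  have K: "0 \<le> K" using R by (simp add: K_def sum_nonneg)
  have e: "0 < \<epsilon>" "\<epsilon> \<le> 1" using K R by (auto simp: \<epsilon>_def add_pos_nonneg)
  have ee: "\<epsilon>\<^sup>2 \<le> \<epsilon>" using e by (simp add: power2_eq_square mult_left_le)
  have small: "\<epsilon> * x \<le> y" if "x \<le> y * (1 + R + R\<^sup>2 + 2 * K)" for x y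
    using that K R by (simp add: \<epsilon>_def divide_le_eq add_pos_nonneg)
  have e1: "\<epsilon> * R \<le> 1" using K R by (intro small) auto
  have e2: "\<epsilon> * (R\<^sup>2 + R) \<le> 1" using K R by (intro small) auto
  have e3: "\<epsilon> * K \<le> 1 / 2" using K R by (intro small) (auto simp: algebra_simps)
  have e2': "\<epsilon>\<^sup>2 * (R\<^sup>2 + R) \<le> 1"
    using mult_right_mono[OF ee, of "R\<^sup>2 + R"] e2 R by simp
  have e3': "\<epsilon>\<^sup>2 * K \<le> 1 / 2" using mult_right_mono[OF ee K] e3 by simp
  show ?thesis
  proof (intro exI[of _ \<epsilon>] conjI allI impI e e1)
    fix p \<zeta> assume p: "p \<in> S2" "p $ 1 \<le> 0" "west_chart p = of_real \<epsilon> * \<zeta>" and z: "norm \<zeta> \<le> R"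
    let ?l = "\<lambda>j. clin (isotropic (w j / of_real \<epsilon>)) p"
    have summand: "norm (c j * ?l j ^ n - c j * (1 + w j * \<zeta>) ^ n)
        \<le> norm (c j) * (real n * (R + 2) ^ n * (\<epsilon>\<^sup>2 * (R\<^sup>2 + R)))" for j
    proof -
      have d: "norm (?l j - (1 + w j * \<zeta>)) \<le> \<epsilon>\<^sup>2 * (R\<^sup>2 + R)"
        by (rule clin_isotropic_west[OF w e(1) p z])
      have y: "norm (1 + w j * \<zeta>) \<le> R + 1"
        using norm_triangle_ineq[of 1 "w j * \<zeta>"] z w[of j] by (simp add: norm_mult)
      have "norm (?l j) \<le> norm (1 + w j * \<zeta>) + norm (?l j - (1 + w j * \<zeta>))"
        by (rule norm_triangle_sub)
      then have "norm (?l j) \<le> R + 2" using y d e2' by linarith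
      then have "norm (?l j ^ n - (1 + w j * \<zeta>) ^ n) \<le> real n * (R + 2) ^ n * norm (?l j - (1 + w j * \<zeta>))"
        using y R by (intro norm_power_diff_le) auto
      also have "\<dots> \<le> real n * (R + 2) ^ n * (\<epsilon>\<^sup>2 * (R\<^sup>2 + R))"
        using d R by (intro mult_left_mono) auto
      finally show ?thesis
        unfolding right_diff_distrib[symmetric] norm_mult by (intro mult_left_mono) auto
    qed
    have "\<bar>power_comb {..n} c (\<lambda>j. isotropic (w j / of_real \<epsilon>)) n p - Re (\<Sum>j\<le>n. c j * (1 + w j * \<zeta>) ^ n)\<bar>
       = \<bar>Re (\<Sum>j\<le>n. c j * ?l j ^ n - c j * (1 + w j * \<zeta>) ^ n)\<bar>"
      by (simp add: power_comb_def sum_subtractf)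
    also have "\<dots> \<le> norm (\<Sum>j\<le>n. c j * ?l j ^ n - c j * (1 + w j * \<zeta>) ^ n)" by (rule abs_Re_le_cmod)
    also have "\<dots> \<le> (\<Sum>j\<le>n. norm (c j) * (real n * (R + 2) ^ n * (\<epsilon>\<^sup>2 * (R\<^sup>2 + R))))"
      by (intro sum_norm_le summand)
    also have "\<dots> = \<epsilon>\<^sup>2 * K" unfolding K_def sum_distrib_right[symmetric] by (simp add: mult_ac)
    finally show "\<bar>power_comb {..n} c (\<lambda>j. isotropic (w j / of_real \<epsilon>)) n p
        - Re (\<Sum>j\<le>n. c j * (1 + w j * \<zeta>) ^ n)\<bar> \<le> 1 / 2" using e3' by linarith
  qed
qed

section \<open>Assembly of the eigenfunctions and discs\<close>

text \<open>The polynomial is at most -1 off the half-strip and the model error is at most 1 / 2, so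
  inside the disc of radius \<open>\<epsilon> * R\<close> positivity requires |z| <= 3
  \<open>\<epsilon>\<close> for the third coordinate z. With \<open>r = \<epsilon> * R\<close> the
  quotient of \<open>24 * r * \<epsilon>\<close> and \<open>r\<^sup>2 / 8\<close> is 192 /
  R.\<close>

lemma sparse_positivity:
  assumes R: "4 \<le> R" and n: "exp (5 * R + 7) \<le> real n"
  shows "\<exists>f r. sphere_eigenfunction f (real n * (real n + 1)) \<and> 0 < r \<and> r < pi \<and> f west = 0 \<and>
     measure sphere_area ({x \<in> S2. f x > 0} \<inter> sphere_disc west r)
       / measure sphere_area (sphere_disc west r) \<le> 192 / R"
proof -
  have R0: "0 \<le> R" using R by simp
  obtain q :: "nat \<Rightarrow> complex" where q0: "q 0 = 0"
    and q: "\<And>\<zeta>. norm \<zeta> \<le> R \<Longrightarrow> Re \<zeta> \<le> - 3 \<or> 3 \<le> \<bar>Im \<zeta>\<bar> \<Longrightarrow> Re (\<Sum>k\<le>n. q k * \<zeta> ^ k) \<le> - 1"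
    using polynomial_negative_off_half_strip[OF R0 n] by blast
  obtain c w :: "nat \<Rightarrow> complex" where w: "\<And>j. norm (w j) = 1"
    and cw: "\<And>\<zeta>. (\<Sum>k\<le>n. q k * \<zeta> ^ k) = (\<Sum>j\<le>n. c j * (1 + w j * \<zeta>) ^ n)"
    using polynomial_as_sum_of_powers[of q n] by blast
  obtain \<epsilon> where e: "0 < \<epsilon>" "\<epsilon> * R \<le> 1" and model: "\<And>p \<zeta>. p \<in> S2 \<Longrightarrow> p $ 1 \<le> 0 \<Longrightarrow>
      west_chart p = of_real \<epsilon> * \<zeta> \<Longrightarrow> norm \<zeta> \<le> R \<Longrightarrow>
     \<bar>power_comb {..n} c (\<lambda>j. isotropic (w j / of_real \<epsilon>)) n p - Re (\<Sum>j\<le>n. c j * (1 + w j * \<zeta>) ^ n)\<bar> \<le> 1 / 2"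
    using power_comb_local_model[of w R n c] w R0 by blast
  define f where "f = power_comb {..n} c (\<lambda>j. isotropic (w j / of_real \<epsilon>)) n"
  define r where "r = \<epsilon> * R"
  have r: "0 < r" "r \<le> 1" "r < pi" using e R pi_gt3 by (auto simp: r_def)
  have neg: "f p < 0" if "p \<in> S2" "p $ 1 \<le> 0" "west_chart p = of_real \<epsilon> * \<zeta>" "norm \<zeta> \<le> R"
    "Re \<zeta> \<le> - 3 \<or> 3 \<le> \<bar>Im \<zeta>\<bar>" for p \<zeta>
    using model[OF that(1-4)] q[OF that(4,5)] unfolding cw f_def by linarith
  \<comment> \<open>The zero at the centre is exact: every linear form equals 1 at
    \<open>west\<close>, so \<open>f west\<close> is the real part of the polynomial at 0.\<close>
  have "f west = Re (\<Sum>j\<le>n. c j)"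
    by (simp add: f_def power_comb_def clin_def isotropic_def west_def)
  also have "\<dots> = 0" using cw[of 0] q0 by (simp add: power_0_left if_distrib cong: if_cong)
  finally have fw: "f west = 0" .
  \<comment> \<open>The point with \<open>\<zeta> = - 3\<close>, left of the half-strip;
    \<open>f\<close> is negative there, hence not identically zero.\<close>
  define p :: "real ^ 3" where "p = vector [- sqrt (1 - (3 * \<epsilon>)\<^sup>2), - 3 * \<epsilon>, 0]"
  have "3 * \<epsilon> \<le> 1" using e mult_left_mono[of 3 R \<epsilon>] R by linarith
  then have "(3 * \<epsilon>)\<^sup>2 \<le> 1" using e by (intro power_le_one) auto
  then have "f p < 0"
    using R by (intro neg[of _ "- 3"])
      (auto simp: p_def west_chart_def complex_eq_iff norm_eq_1 inner_vec_def sum_3 power2_eq_square)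
  moreover have "p \<in> S2"
    using \<open>(3 * \<epsilon>)\<^sup>2 \<le> 1\<close> by (simp add: p_def norm_eq_1 inner_vec_def sum_3 power2_eq_square)
  moreover have "w j \<noteq> 0" for j using w[of j] by auto
  ultimately have eig: "sphere_eigenfunction f (real n * (real n + 1))"
    using e unfolding f_def by (intro power_comb_eigenfunction isotropic_squares) auto
  define B where "B = {x. f x > 0} \<inter> {x. cos r < - x $ 1}"
  have "continuous_on UNIV f" using power_comb_Ck_on[of 0] by (simp add: f_def)
  then have "open {x. f x > 0}" by (intro open_Collect_less) auto
  then have B: "B \<in> sets borel" unfolding B_def using borel_disc by auto
  have "measure sphere_area (B \<inter> S2) \<le> 8 * r * (3 * \<epsilon>)"
  proof (rule sphere_strip_area_le[OF r(1,2) _ B])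
    fix x assume x: "x \<in> S2" "x \<in> B"
    have cr: "0 < cos r" using r pi_gt3 by (intro cos_gt_zero) auto
    have x1: "x $ 1 \<le> 0" using x cr by (simp add: B_def)
    define \<zeta> where "\<zeta> = west_chart x / of_real \<epsilon>"
    have ch: "west_chart x = of_real \<epsilon> * \<zeta>" using e by (simp add: \<zeta>_def)
    \<comment> \<open>The disc projects into the disc of radius sin r <= r =
      \<open>\<epsilon> * R\<close>, so the rescaled variable stays within radius
      \<open>R\<close>.\<close>
    have "(cos r)\<^sup>2 \<le> (- x $ 1)\<^sup>2" using x cr by (intro power_mono) (auto simp: B_def)
    then have "(norm (west_chart x))\<^sup>2 \<le> (sin r)\<^sup>2"
      using norm_west_chart[OF x(1)] by (simp add: sin_squared_eq)
    moreover have "0 \<le> sin r" using r by (intro sin_ge_zero) auto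
    ultimately have "norm (west_chart x) \<le> sin r" by (rule power2_le_imp_le)
    also have "\<dots> \<le> r" using r by (intro sin_x_le_x) auto
    finally have "norm \<zeta> \<le> R" using e by (simp add: \<zeta>_def norm_divide r_def divide_le_eq mult.commute)
    then have "\<bar>Im \<zeta>\<bar> \<le> 3" using neg[OF x(1) x1 ch] x(2) by (cases "3 \<le> \<bar>Im \<zeta>\<bar>") (auto simp: B_def)
    moreover have "x $ 3 = \<epsilon> * Im \<zeta>" using arg_cong[OF ch, of Im] by (simp add: west_chart_def)
    ultimately have "\<bar>x $ 3\<bar> \<le> 3 * \<epsilon>" using e by (simp add: abs_mult)
    then show "cos r < - x $ 1 \<and> \<bar>x $ 3\<bar> \<le> 3 * \<epsilon>" using x by (simp add: B_def)
  qed (use e in auto)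
  moreover have "{x \<in> S2. f x > 0} \<inter> sphere_disc west r = B \<inter> S2"
    using r by (auto simp: sphere_disc_west B_def)
  moreover have "r\<^sup>2 / 8 \<le> measure sphere_area (sphere_disc west r)"
    using r by (intro sphere_disc_west_area_ge)
  ultimately have "measure sphere_area ({x \<in> S2. f x > 0} \<inter> sphere_disc west r)
       / measure sphere_area (sphere_disc west r) \<le> (8 * r * (3 * \<epsilon>)) / (r\<^sup>2 / 8)"
    using r e by (intro frac_le) auto
  also have "\<dots> = 192 / R" using e R by (simp add: r_def power2_eq_square)
  finally show ?thesis using eig fw r by blast
qed

theorem theorem1p5:
  "\<exists>C > (0::real). \<exists>(f :: nat \<Rightarrow> real ^ 3 \<Rightarrow> real) (\<mu> :: nat \<Rightarrow> real)
      (c :: nat \<Rightarrow> real ^ 3) (r :: nat \<Rightarrow> real).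
     (\<forall>i. sphere_eigenfunction (f i) (\<mu> i)) \<and>
     filterlim \<mu> at_top sequentially \<and>
     (\<forall>i. c i \<in> S2 \<and> 0 < r i \<and> r i < pi \<and> f i (c i) = 0 \<and>
        measure sphere_area ({x \<in> S2. f i x > 0} \<inter> sphere_disc (c i) (r i))
          / measure sphere_area (sphere_disc (c i) (r i))
        \<le> C / ln (\<mu> i))"
proof -
  define R where "R = (\<lambda>i. real i + 4)"
  \<comment> \<open>The least degree that the radius \<open>R i\<close> allows, so that
    \<open>ln (n i)\<close> is comparable to \<open>R i\<close>.\<close>
  define n where "n = (\<lambda>i. nat \<lceil>exp (5 * R i + 7)\<rceil>)"
  define \<mu> where "\<mu> = (\<lambda>i. real (n i) * (real (n i) + 1))"
  have R: "4 \<le> R i" for i by (simp add: R_def)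
  have n: "exp (5 * R i + 7) \<le> real (n i)" for i by (simp add: n_def)
  have ceil0: "0 \<le> \<lceil>exp (5 * R i + 7)\<rceil>" for i
    using exp_gt_zero[of "5 * R i + 7"] le_of_int_ceiling[of "exp (5 * R i + 7)"] by linarith
  have n1: "1 \<le> real (n i)" and nR: "R i \<le> real (n i)" for i
    using n[of i] exp_ge_add_one_self[of "5 * R i + 7"] R[of i] by linarith+
  define P where "P = (\<lambda>i f r. sphere_eigenfunction f (\<mu> i) \<and> 0 < r \<and> r < pi \<and> f west = 0 \<and>
     measure sphere_area ({x \<in> S2. f x > 0} \<inter> sphere_disc west r)
       / measure sphere_area (sphere_disc west r) \<le> 192 / R i)"
  have "\<exists>f r. P i f r" for i
    unfolding P_def \<mu>_def by (rule sparse_positivity[OF R n])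
  then obtain f r where "\<And>i. P i (f i) (r i)" by metis
  then have fr: "sphere_eigenfunction (f i) (\<mu> i) \<and> 0 < r i \<and> r i < pi \<and> f i west = 0 \<and>
     measure sphere_area ({x \<in> S2. f i x > 0} \<inter> sphere_disc west (r i))
       / measure sphere_area (sphere_disc west (r i)) \<le> 192 / R i" for i
    by (simp only: P_def)
  \<comment> \<open>From \<open>\<mu> i \<le> exp (5 * R i + 8) ^ 2\<close> follows ln
    \<open>(\<mu> i)\<close> <= 10 R + 16 <= 16 R, and 3072 = 192 * 16.\<close>
  have bound: "192 / R i \<le> 3072 / ln (\<mu> i)" for i
  proof -
    have "real (n i) \<le> exp (5 * R i + 7) + 1" 
      using of_int_ceiling_le_add_one[of "exp (5 * R i + 7)"] ceil0[of i] by (simp add: n_def)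
    moreover have "2 * exp (5 * R i + 7) \<le> exp 1 * exp (5 * R i + 7)"
      using exp_ge_add_one_self[of 1] by (intro mult_right_mono) auto
    moreover have "exp 1 * exp (5 * R i + 7) = exp (5 * R i + 8)" by (simp add: exp_add[symmetric])
    moreover have "2 \<le> exp (5 * R i + 7)" using exp_ge_add_one_self[of "5 * R i + 7"] R[of i] by linarith
    ultimately have *: "real (n i) + 1 \<le> exp (5 * R i + 8)" by linarith
    have "1 * (1 + 1) \<le> \<mu> i" unfolding \<mu>_def using n1[of i] by (intro mult_mono) auto
    then have pos: "1 < \<mu> i" by simp
    have "\<mu> i \<le> exp (5 * R i + 8) * exp (5 * R i + 8)"
      unfolding \<mu>_def using * by (intro mult_mono) auto
    then have "ln (\<mu> i) \<le> ln (exp (5 * R i + 8) * exp (5 * R i + 8))" using pos by (subst ln_le_cancel_iff) auto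
    also have "\<dots> = 10 * R i + 16" by (simp add: exp_add[symmetric])
    finally have "ln (\<mu> i) \<le> 16 * R i" using R[of i] by linarith
    moreover have "0 < ln (\<mu> i)" using pos by simp
    ultimately show ?thesis using R[of i] by (simp add: field_simps)
  qed
  have "real i \<le> \<mu> i" for i
  proof -
    have "real i * 1 \<le> \<mu> i" unfolding \<mu>_def using nR[of i] n1[of i] by (intro mult_mono) (auto simp: R_def)
    then show ?thesis by simp
  qed
  then have \<mu>_lim: "filterlim \<mu> at_top sequentially"
    by (intro filterlim_at_top_mono[OF filterlim_real_sequentially]) auto
  show ?thesis
  proof (rule exI[of _ 3072], rule conjI, simp, rule exI[of _ f], rule exI[of _ \<mu>],
      rule exI[of _ "\<lambda>_. west"], rule exI[of _ r], intro conjI allI)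
    fix i
    show "measure sphere_area ({x \<in> S2. f i x > 0} \<inter> sphere_disc west (r i))
          / measure sphere_area (sphere_disc west (r i)) \<le> 3072 / ln (\<mu> i)"
      using fr[of i] bound[of i] by (elim conjE) (rule order_trans)
  qed (simp_all only: fr \<mu>_lim west_in_S2)
qed

end
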